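(* For any $\alpha>0$, there exist separable complex Hilbert spaces $X$ and $Y$, a compact set $\mathcal{K}\subset X$, a mapping $u:X\to Y$ that is holomorphic on every bounded open subset of $X$, and constants $C_1,c_1,C_2,c_2,C_3,c_3,C_4,c_4>0$ such that for every $n\ge1$ $$C_1\,\mathrm{e}^{-c_1n^\alpha}\le d_n(\mathcal{K})_X\le C_2\,\mathrm{e}^{-c_2n^\alpha},$$ $$C_3\,\mathrm{e}^{-c_3[\log(n+2)]^{\alpha+1}}\le d_n(u(\mathcal{K}))_Y\le C_4\,\mathrm{e}^{-c_4[\log(n+2)]^{\alpha+1}}.$$
   Context: For a compact subset $\mathcal{A}$ of a Banach space $Z$ and an integer $n\ge 1$, the Kolmogorov $n$-width is $$d_n(\mathcal{A})_Z:=\inf_{\substack{V_n\subset Z\\ \dim V_n\le n}}\ \sup_{a\in\mathcal{A}}\ \inf_{v\in V_n}\|a-v\|_Z,$$ where $V_n$ ranges over linear subspaces of $Z$ of dimension at most $n$. For $m\ge1$, a continuous $m$-homogeneous polynomial $P:X\to Y$ is a continuous map of the form $P(x)=A(x,\ldots,x)$ for some $m$-linear map $A:X^m\to Y$. A mapping $u:\mathcal{O}\to Y$ on an open set $\mathcal{O}\subset X$ is holomorphic if for every $a\in\mathcal{O}$ there exist an open ball $B_X(a,r)\subset\mathcal{O}$ and continuous $m$-homogeneous polynomials $P_{a,m}:X\to Y$, $m\ge1$, such that $u(x)=u(a)+\sum_{m=1}^\infty P_{a,m}(x-a)$ uniformly for $x\in B_X(a,r)$ (equivalently, $u$ is complex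 Fréchet differentiable on $\mathcal{O}$). The constants in the claim are independent of $n$. *)

theory Defs
  imports "HOL-Analysis.Analysis" "HOL-Algebra.Module"
begin

section \<open>Complex Hilbert spaces with an explicit carrier\<close>

text \<open>
  Existentially quantified Hilbert spaces cannot be rendered by types of a type class, so a complex
  Hilbert space is a module over the ring of complex numbers (in the sense of \<^verbatim>\<open>HOL-Algebra\<close>)
  together with an inner product. The fields \<^verbatim>\<open>mult\<close> and \<^verbatim>\<open>one\<close> that the record inherits play no
  role.
\<close>

definition complex_ring :: "complex ring"
  where "complex_ring = \<lparr>carrier = UNIV, mult = (*), one = 1, zero = 0, add = (+)\<rparr>"

record 'a inner_module = "(complex, 'a) module" +
  inprod :: "'a \<Rightarrow> 'a \<Rightarrow> complex"

definition hnorm :: "'a inner_module \<Rightarrow> 'a \<Rightarrow> real"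
  where "hnorm X x = sqrt (Re (inprod X x x))"

text \<open>
  The locale \<^locale>\<open>Metric_space\<close> wants nonnegativity and symmetry of the distance also outside the
  carrier, hence the case distinction.
\<close>

definition hdist :: "'a inner_module \<Rightarrow> 'a \<Rightarrow> 'a \<Rightarrow> real"
  where "hdist X x y =
    (if x \<in> carrier X \<and> y \<in> carrier X then hnorm X (x \<ominus>\<^bsub>X\<^esub> y) else 0)"

abbreviation htopology :: "'a inner_module \<Rightarrow> 'a topology"
  where "htopology X \<equiv> Metric_space.mtopology (carrier X) (hdist X)"

abbreviation hball :: "'a inner_module \<Rightarrow> 'a \<Rightarrow> real \<Rightarrow> 'a set"
  where "hball X \<equiv> Metric_space.mball (carrier X) (hdist X)"

abbreviation hbounded :: "'a inner_module \<Rightarrow> 'a set \<Rightarrow> bool"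
  where "hbounded X \<equiv> Metric_space.mbounded (carrier X) (hdist X)"

locale complex_inner_space = module complex_ring X for X :: "'a inner_module" (structure) +
  assumes inprod_commute:
      "\<lbrakk>x \<in> carrier X; y \<in> carrier X\<rbrakk> \<Longrightarrow> inprod X x y = cnj (inprod X y x)"
    and inprod_add_left:
      "\<lbrakk>x \<in> carrier X; y \<in> carrier X; z \<in> carrier X\<rbrakk> \<Longrightarrow>
        inprod X (x \<oplus> y) z = inprod X x z + inprod X y z"
    and inprod_smult_left:
      "\<lbrakk>x \<in> carrier X; y \<in> carrier X\<rbrakk> \<Longrightarrow> inprod X (c \<odot> x) y = c * inprod X x y"
    and inprod_pos:
      "\<lbrakk>x \<in> carrier X; x \<noteq> \<zero>\<rbrakk> \<Longrightarrow> 0 < Re (inprod X x x)"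
begin

lemma inprod_zero_left: "y \<in> carrier X \<Longrightarrow> inprod X \<zero> y = 0"
  using inprod_add_left[of \<zero> \<zero> y] by simp

lemma inprod_minus_left:
  assumes "x \<in> carrier X" "y \<in> carrier X"
  shows "inprod X (\<ominus> x) y = - inprod X x y"
proof -
  have "inprod X (\<ominus> x) y + inprod X x y = inprod X (\<ominus> x \<oplus> x) y"
    using assms by (simp add: inprod_add_left)
  also have "\<dots> = 0"
    using assms by (simp add: M.l_neg inprod_zero_left)
  finally show ?thesis by (simp add: eq_neg_iff_add_eq_0)
qed

lemma inprod_nonneg: "x \<in> carrier X \<Longrightarrow> 0 \<le> Re (inprod X x x)"
  using inprod_pos[of x] inprod_zero_left[of \<zero>] by (cases "x = \<zero>") auto

lemma inprod_add_right:
  assumes "x \<in> carrier X" "y \<in> carrier X" "z \<in> carrier X"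
  shows "inprod X x (y \<oplus> z) = inprod X x y + inprod X x z"
proof -
  have "inprod X x (y \<oplus> z) = cnj (inprod X (y \<oplus> z) x)"
    using assms inprod_commute[of x "y \<oplus> z"] by simp
  then show ?thesis
    using assms inprod_add_left[of y z x] inprod_commute[of x y] inprod_commute[of x z] by simp
qed

lemma inprod_smult_right:
  assumes "x \<in> carrier X" "y \<in> carrier X"
  shows "inprod X x (c \<odot> y) = cnj c * inprod X x y"
proof -
  have "c \<odot> y \<in> carrier X"
    using assms by (simp add: complex_ring_def)
  then have "inprod X x (c \<odot> y) = cnj (inprod X (c \<odot> y) x)"
    using assms inprod_commute[of x "c \<odot> y"] by simp
  then show ?thesis
    using assms inprod_smult_left[of y x c] inprod_commute[of x y] by simp
qed

lemma hnorm_nonneg: "x \<in> carrier X \<Longrightarrow> 0 \<le> hnorm X x"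
  by (simp add: hnorm_def inprod_nonneg)

lemma hnorm_power2: "x \<in> carrier X \<Longrightarrow> (hnorm X x)\<^sup>2 = Re (inprod X x x)"
  by (simp add: hnorm_def inprod_nonneg)

lemma hnorm_eq_0: "x \<in> carrier X \<Longrightarrow> hnorm X x = 0 \<longleftrightarrow> x = \<zero>"
  using inprod_pos[of x] inprod_zero_left[of \<zero>]
  by (cases "x = \<zero>") (auto simp: hnorm_def)

lemma Re_inprod_le:
  assumes x: "x \<in> carrier X" and y: "y \<in> carrier X"
  shows "Re (inprod X x y) \<le> hnorm X x * hnorm X y"
proof (cases "y = \<zero>")
  case True
  then show ?thesis
    using x y inprod_commute[of x \<zero>] inprod_zero_left[of x] hnorm_eq_0[of \<zero>] by simp
next
  case False
  define b where "b = Re (inprod X x y)"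
  define d where "d = Re (inprod X y y)"
  define t where "t = - b / d"
  have d: "d > 0" using False y inprod_pos d_def by simp
  define z where "z = complex_of_real t \<odot> y"
  have z: "z \<in> carrier X" using y by (simp add: z_def complex_ring_def)
  have "Re (inprod X y x) = b"
    using inprod_commute[OF y x] by (simp add: b_def)
  then have "Re (inprod X (x \<oplus> z) (x \<oplus> z)) = Re (inprod X x x) + 2 * t * b + t\<^sup>2 * d"
    using x y z
    by (simp add: inprod_add_left inprod_add_right z_def inprod_smult_left inprod_smult_right
        b_def d_def power2_eq_square algebra_simps)
  moreover have "0 \<le> Re (inprod X (x \<oplus> z) (x \<oplus> z))"
    using x z inprod_nonneg by simp
  ultimately have "0 \<le> Re (inprod X x x) - b\<^sup>2 / d"
    using d by (simp add: t_def power2_eq_square)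
  then have "b\<^sup>2 \<le> (hnorm X x * hnorm X y)\<^sup>2"
    using d x y by (simp add: power_mult_distrib hnorm_power2 d_def field_simps)
  then show ?thesis
    using x y by (metis b_def hnorm_nonneg mult_nonneg_nonneg power2_le_imp_le)
qed

lemma hnorm_triangle:
  assumes x: "x \<in> carrier X" and y: "y \<in> carrier X"
  shows "hnorm X (x \<oplus> y) \<le> hnorm X x + hnorm X y"
proof (rule power2_le_imp_le)
  have "(hnorm X (x \<oplus> y))\<^sup>2 = (hnorm X x)\<^sup>2 + 2 * Re (inprod X x y) + (hnorm X y)\<^sup>2"
    using x y inprod_commute[OF y x]
    by (simp add: hnorm_power2 inprod_add_left inprod_add_right)
  also have "\<dots> \<le> (hnorm X x + hnorm X y)\<^sup>2"
    using Re_inprod_le[OF x y] by (simp add: power2_sum)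
  finally show "(hnorm X (x \<oplus> y))\<^sup>2 \<le> (hnorm X x + hnorm X y)\<^sup>2" .
qed (use x y hnorm_nonneg in simp)

lemma hnorm_minus: "x \<in> carrier X \<Longrightarrow> hnorm X (\<ominus> x) = hnorm X x"
  using inprod_commute[of x "\<ominus> x"]
  by (simp add: hnorm_def inprod_minus_left)

sublocale Metric_space "carrier X" "hdist X"
proof
  fix x y z
  show "0 \<le> hdist X x y"
    by (simp add: hdist_def hnorm_nonneg)
  show "hdist X x y = hdist X y x"
  proof (cases "x \<in> carrier X \<and> y \<in> carrier X")
    case True
    then have "x \<ominus> y = \<ominus> (y \<ominus> x)"
      by (simp add: a_minus_def M.minus_add M.a_comm)
    then show ?thesis
      using True by (simp add: hdist_def hnorm_minus)
  qed (auto simp: hdist_def)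
  show "hdist X x y = 0 \<longleftrightarrow> x = y" if "x \<in> carrier X" "y \<in> carrier X"
    using that by (simp add: hdist_def hnorm_eq_0 a_minus_def)
      (metis M.add.inv_solve_right M.l_zero M.zero_closed M.r_neg)
  show "hdist X x z \<le> hdist X x y + hdist X y z"
    if "x \<in> carrier X" "y \<in> carrier X" "z \<in> carrier X"
  proof -
    have "(x \<ominus> y) \<oplus> (y \<ominus> z) = x \<oplus> (\<ominus> y \<oplus> y) \<oplus> \<ominus> z"
      using that by (simp add: a_minus_def M.a_assoc del: M.l_neg)
    then have "x \<ominus> z = (x \<ominus> y) \<oplus> (y \<ominus> z)"
      using that by (simp add: a_minus_def M.l_neg)
    then show ?thesis
      using that hnorm_triangle[of "x \<ominus> y" "y \<ominus> z"] by (simp add: hdist_def)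
  qed
qed

end

locale complex_hilbert_space = complex_inner_space +
  assumes complete: mcomplete


section \<open>Kolmogorov widths\<close>

definition is_basis :: "'a inner_module \<Rightarrow> 'a set \<Rightarrow> 'a set \<Rightarrow> bool"
  where "is_basis X V B \<longleftrightarrow>
    finite B \<and> B \<subseteq> V \<and>
    (\<forall>c. (\<Oplus>\<^bsub>X\<^esub>b\<in>B. c b \<odot>\<^bsub>X\<^esub> b) = \<zero>\<^bsub>X\<^esub> \<longrightarrow> (\<forall>b\<in>B. c b = 0)) \<and>
    (\<forall>v\<in>V. \<exists>c. v = (\<Oplus>\<^bsub>X\<^esub>b\<in>B. c b \<odot>\<^bsub>X\<^esub> b))"

definition subspaces_dim_le :: "'a inner_module \<Rightarrow> nat \<Rightarrow> 'a set set"
  where "subspaces_dim_le X n =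
    {V. submodule V complex_ring X \<and> (\<exists>B. is_basis X V B \<and> card B \<le> n)}"

text \<open>
  The infima and suprema are taken in \<^typ>\<open>ennreal\<close>, where they always exist.
\<close>

definition kolmogorov_width :: "'a inner_module \<Rightarrow> nat \<Rightarrow> 'a set \<Rightarrow> ennreal"
  where "kolmogorov_width X n A =
    (INF V \<in> subspaces_dim_le X n. SUP a \<in> A. INF v \<in> V. ennreal (hnorm X (a \<ominus>\<^bsub>X\<^esub> v)))"


section \<open>Holomorphic maps\<close>

definition linear_between :: "'a inner_module \<Rightarrow> 'b inner_module \<Rightarrow> ('a \<Rightarrow> 'b) \<Rightarrow> bool"
  where "linear_between X Y f \<longleftrightarrow>
    f \<in> carrier X \<rightarrow> carrier Y \<and>
    (\<forall>x\<in>carrier X. \<forall>y\<in>carrier X. f (x \<oplus>\<^bsub>X\<^esub> y) = f x \<oplus>\<^bsub>Y\<^esub> f y) \<and>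
    (\<forall>c. \<forall>x\<in>carrier X. f (c \<odot>\<^bsub>X\<^esub> x) = c \<odot>\<^bsub>Y\<^esub> f x)"

text \<open>The product of \<open>m\<close> copies of the carrier is the set of extensional functions on \<open>{..<m}\<close>.\<close>

definition multilinear_between ::
    "'a inner_module \<Rightarrow> 'b inner_module \<Rightarrow> nat \<Rightarrow> ((nat \<Rightarrow> 'a) \<Rightarrow> 'b) \<Rightarrow> bool"
  where "multilinear_between X Y m A \<longleftrightarrow>
    A \<in> ({..<m} \<rightarrow>\<^sub>E carrier X) \<rightarrow> carrier Y \<and>
    (\<forall>i<m. \<forall>x \<in> {..<m} \<rightarrow>\<^sub>E carrier X. linear_between X Y (\<lambda>t. A (x(i := t))))"

definition continuous_homogeneous_polynomial ::
    "'a inner_module \<Rightarrow> 'b inner_module \<Rightarrow> nat \<Rightarrow> ('a \<Rightarrow> 'b) \<Rightarrow> bool"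
  where "continuous_homogeneous_polynomial X Y m P \<longleftrightarrow>
    continuous_map (htopology X) (htopology Y) P \<and>
    (\<exists>A. multilinear_between X Y m A \<and> (\<forall>x\<in>carrier X. P x = A (\<lambda>i\<in>{..<m}. x)))"

definition holomorphic_between ::
    "'a inner_module \<Rightarrow> 'b inner_module \<Rightarrow> 'a set \<Rightarrow> ('a \<Rightarrow> 'b) \<Rightarrow> bool"
  where "holomorphic_between X Y U u \<longleftrightarrow>
    openin (htopology X) U \<and> u \<in> U \<rightarrow> carrier Y \<and>
    (\<forall>a\<in>U. \<exists>r>0. \<exists>P. hball X a r \<subseteq> U \<and>
      (\<forall>m\<ge>1. continuous_homogeneous_polynomial X Y m (P m)) \<and>
      uniform_limit (hball X a r)
        (\<lambda>N x. hdist Y (u a \<oplus>\<^bsub>Y\<^esub> (\<Oplus>\<^bsub>Y\<^esub>m\<in>{1..N}. P m (x \<ominus>\<^bsub>X\<^esub> a))) (u x))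
        (\<lambda>x. 0) sequentially)"

end

theory Submission
  imports Defs "HOL-Library.Discrete_Functions" "HOL-Real_Asymp.Real_Asymp"
begin

text \<open>
  Take \<open>X = Y = \<ell>\<^sup>2\<close> and the box \<open>K = {x. \<bar>x\<^sub>k\<bar> \<le> \<tau>(k div 2)}\<close> with \<open>\<tau>(j) = exp (- (j + 1)\<^sup>\<alpha>)\<close>. The
  coordinates of \<open>u\<close> come in blocks: block \<open>J\<close> consists of the \<open>2\<^sup>J\<close> products that contain, for each
  \<open>j < J\<close>, exactly one of \<open>x\<^sub>2\<^sub>j\<close> and \<open>x\<^sub>2\<^sub>j\<^sub>+\<^sub>1\<close>. On \<open>K\<close> each of them is at most
  \<open>exp (- \<Sum>j<J. (j + 1)\<^sup>\<alpha>)\<close>, which is about \<open>exp (- c J\<^sup>\<alpha>\<^sup>+\<^sup>1)\<close>, while about \<open>2\<^sup>J\<close> coordinates precede the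
  block, so that \<open>J\<close> is of the order of \<open>ln n\<close>.

  The squared norm of block \<open>J\<close> is \<open>\<Prod>j<J. (\<bar>x\<^sub>2\<^sub>j\<bar>\<^sup>2 + \<bar>x\<^sub>2\<^sub>j\<^sub>+\<^sub>1\<bar>\<^sup>2) \<le> \<parallel>x\<parallel>\<^sup>2\<^sup>J / J!\<close>. Hence the tails
  are uniformly small on bounded sets, and since block \<open>J\<close> is a polynomial of degree \<open>J\<close>, the Taylor
  expansions of \<open>u\<close> converge uniformly on balls.

  Upper bounds for the widths come from truncation. For the lower bounds, a subspace of dimension
  \<open>n\<close> has a nonzero orthogonal vector \<open>y\<close> supported on any given \<open>n + 1\<close> coordinates, and it suffices
  to find an element of the set whose inner product with \<open>y\<close> is large.
\<close>

section \<open>The Hilbert space of square-summable sequences\<close>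

definition ell2 :: "(nat \<Rightarrow> complex) inner_module"
  where "ell2 = \<lparr>carrier = {x. summable (\<lambda>k. (cmod (x k))\<^sup>2)}, mult = (\<lambda>x y. x), one = (\<lambda>_. 0),
    zero = (\<lambda>_. 0), add = (\<lambda>x y k. x k + y k), smult = (\<lambda>c x k. c * x k),
    inprod = (\<lambda>x y. \<Sum>k. x k * cnj (y k))\<rparr>"

lemma carrier_ell2: "x \<in> carrier ell2 \<longleftrightarrow> summable (\<lambda>k. (cmod (x k))\<^sup>2)"
  by (simp add: ell2_def)

lemma ell2_simps [simp]:
  "\<zero>\<^bsub>ell2\<^esub> = (\<lambda>_. 0)"
  "x \<oplus>\<^bsub>ell2\<^esub> y = (\<lambda>k. x k + y k)"
  "c \<odot>\<^bsub>ell2\<^esub> x = (\<lambda>k. c * x k)"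
  by (simp_all add: ell2_def)

lemma inprod_ell2: "inprod ell2 x y = (\<Sum>k. x k * cnj (y k))"
  by (simp add: ell2_def)

lemma carrier_ell2_add:
  assumes "x \<in> carrier ell2" "y \<in> carrier ell2"
  shows "(\<lambda>k. x k + y k) \<in> carrier ell2"
proof -
  have "(cmod (x k + y k))\<^sup>2 \<le> 2 * (cmod (x k))\<^sup>2 + 2 * (cmod (y k))\<^sup>2" for k
  proof -
    have "(cmod (x k + y k))\<^sup>2 \<le> (cmod (x k) + cmod (y k))\<^sup>2"
      by (intro power_mono norm_triangle_ineq) auto
    also have "\<dots> \<le> 2 * (cmod (x k))\<^sup>2 + 2 * (cmod (y k))\<^sup>2"
      using sum_squares_bound[of "cmod (x k)" "cmod (y k)"] by (simp add: power2_sum)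
    finally show ?thesis .
  qed
  moreover have "summable (\<lambda>k. 2 * (cmod (x k))\<^sup>2 + 2 * (cmod (y k))\<^sup>2)"
    using assms by (intro summable_add summable_mult) (auto simp: carrier_ell2)
  ultimately show ?thesis
    unfolding carrier_ell2 by (elim summable_comparison_test_ev[rotated]) simp
qed

lemma carrier_ell2_smult:
  assumes "x \<in> carrier ell2"
  shows "(\<lambda>k. c * x k) \<in> carrier ell2"
  using assms summable_mult[of "\<lambda>k. (cmod (x k))\<^sup>2" "(cmod c)\<^sup>2"]
  by (simp add: carrier_ell2 norm_mult power_mult_distrib)

lemma carrier_ell2_uminus: "x \<in> carrier ell2 \<Longrightarrow> (\<lambda>k. - x k) \<in> carrier ell2"
  by (simp add: carrier_ell2)

lemma carrier_ell2_diff: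
  "x \<in> carrier ell2 \<Longrightarrow> y \<in> carrier ell2 \<Longrightarrow> (\<lambda>k. x k - y k) \<in> carrier ell2"
  using carrier_ell2_add[of x "\<lambda>k. - y k"] carrier_ell2_uminus[of y] by simp

lemma carrier_ell2_dominated:
  assumes "summable (\<lambda>k. (g k)\<^sup>2)" "\<And>k. cmod (x k) \<le> g k"
  shows "x \<in> carrier ell2"
proof -
  have "norm ((cmod (x k))\<^sup>2) \<le> (g k)\<^sup>2" for k
    using power_mono[OF assms(2)[of k], of 2] by simp
  then show ?thesis
    unfolding carrier_ell2 by (intro summable_comparison_test_ev[OF _ assms(1)]) simp
qed

lemma carrier_ell2_finite_support:
  assumes "finite T" "\<And>k. k \<notin> T \<Longrightarrow> x k = 0"
  shows "x \<in> carrier ell2"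
  unfolding carrier_ell2 by (rule summable_finite[of T]) (use assms in auto)

lemma summable_ell2_inprod:
  assumes "x \<in> carrier ell2" "y \<in> carrier ell2"
  shows "summable (\<lambda>k. x k * cnj (y k))"
proof -
  have "norm (x k * cnj (y k)) \<le> (cmod (x k))\<^sup>2 + (cmod (y k))\<^sup>2" for k
  proof -
    have "0 \<le> cmod (x k) * cmod (y k)" by simp
    then have "cmod (x k) * cmod (y k) \<le> (cmod (x k))\<^sup>2 + (cmod (y k))\<^sup>2"
      using sum_squares_bound[of "cmod (x k)" "cmod (y k)"] by linarith
    then show ?thesis by (simp add: norm_mult)
  qed
  moreover have "summable (\<lambda>k. (cmod (x k))\<^sup>2 + (cmod (y k))\<^sup>2)"
    using assms by (intro summable_add) (auto simp: carrier_ell2)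
  ultimately show ?thesis
    by (elim summable_comparison_test_ev[rotated]) simp
qed

lemma abelian_group_ell2: "abelian_group ell2"
proof (rule abelian_groupI)
  show "\<exists>y\<in>carrier ell2. y \<oplus>\<^bsub>ell2\<^esub> x = \<zero>\<^bsub>ell2\<^esub>" if "x \<in> carrier ell2" for x
    by (rule bexI[of _ "\<lambda>k. - x k"]) (use that carrier_ell2_uminus in auto)
qed (auto simp: carrier_ell2_add add_ac, simp add: carrier_ell2)

lemma cring_complex_ring: "cring complex_ring"
proof -
  have "\<exists>y. y + x = 0" for x :: complex
    by (rule exI[of _ "- x"]) simp
  then show ?thesis
    by (intro cringI abelian_groupI comm_monoidI) (auto simp: complex_ring_def algebra_simps)
qed

lemma module_ell2: "module complex_ring ell2"
  by (rule moduleI[OF cring_complex_ring abelian_group_ell2])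
    (auto simp: carrier_ell2_smult complex_ring_def algebra_simps)

lemma ell2_minus:
  assumes "x \<in> carrier ell2"
  shows "\<ominus>\<^bsub>ell2\<^esub> x = (\<lambda>k. - x k)"
proof -
  interpret abelian_group ell2 by (rule abelian_group_ell2)
  show ?thesis
    by (rule minus_equality) (use assms carrier_ell2_uminus in auto)
qed

lemma ell2_diff:
  assumes "x \<in> carrier ell2" "y \<in> carrier ell2"
  shows "x \<ominus>\<^bsub>ell2\<^esub> y = (\<lambda>k. x k - y k)"
  using assms by (simp add: a_minus_def ell2_minus)

lemma inprod_ell2_self:
  assumes "x \<in> carrier ell2"
  shows "inprod ell2 x x = of_real (\<Sum>k. (cmod (x k))\<^sup>2)"
  using assms
  by (simp add: inprod_ell2 carrier_ell2 suminf_of_real complex_norm_square del: of_real_power)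

interpretation ell2: complex_inner_space ell2
proof (rule complex_inner_space.intro[OF module_ell2], unfold_locales)
  fix x y z :: "nat \<Rightarrow> complex" and c
  assume x: "x \<in> carrier ell2"
  show "0 < Re (inprod ell2 x x)" if nz: "x \<noteq> \<zero>\<^bsub>ell2\<^esub>"
  proof -
    obtain k where "x k \<noteq> 0" using nz by auto
    then have "0 < (\<Sum>k. (cmod (x k))\<^sup>2)"
      using x suminf_pos_iff[of "\<lambda>k. (cmod (x k))\<^sup>2"] by (auto simp: carrier_ell2)
    then show ?thesis using x by (simp add: inprod_ell2_self)
  qed
  assume y: "y \<in> carrier ell2"
  show "inprod ell2 x y = cnj (inprod ell2 y x)"
  proof -
    have "(\<lambda>k. cnj (y k * cnj (x k))) sums cnj (\<Sum>k. y k * cnj (x k))"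
      using summable_ell2_inprod[OF y x] by (intro sums_cnj[THEN iffD2] summable_sums)
    then show ?thesis by (simp add: inprod_ell2 sums_iff mult.commute)
  qed
  show "inprod ell2 (c \<odot>\<^bsub>ell2\<^esub> x) y = c * inprod ell2 x y"
    using suminf_mult[OF summable_ell2_inprod[OF x y], of c] by (simp add: inprod_ell2 mult.assoc)
  assume z: "z \<in> carrier ell2"
  show "inprod ell2 (x \<oplus>\<^bsub>ell2\<^esub> y) z = inprod ell2 x z + inprod ell2 y z"
    using suminf_add[OF summable_ell2_inprod[OF x z] summable_ell2_inprod[OF y z]]
    by (simp add: inprod_ell2 algebra_simps)
qed

lemma hnorm_ell2:
  assumes "x \<in> carrier ell2"
  shows "hnorm ell2 x = sqrt (\<Sum>k. (cmod (x k))\<^sup>2)"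
  using assms by (simp add: hnorm_def inprod_ell2_self)

lemma hdist_ell2:
  assumes "x \<in> carrier ell2" "y \<in> carrier ell2"
  shows "hdist ell2 x y = sqrt (\<Sum>k. (cmod (x k - y k))\<^sup>2)"
  using assms by (simp add: hdist_def ell2_diff hnorm_ell2 carrier_ell2_diff)

lemma cmod_le_hnorm_ell2:
  assumes "x \<in> carrier ell2"
  shows "cmod (x k) \<le> hnorm ell2 x"
proof -
  have "(cmod (x k))\<^sup>2 \<le> (\<Sum>k. (cmod (x k))\<^sup>2)"
    using assms sum_le_suminf[of "\<lambda>k. (cmod (x k))\<^sup>2" "{k}"] by (simp add: carrier_ell2)
  then show ?thesis
    using assms by (simp add: hnorm_ell2 real_le_rsqrt)
qed

lemma hdist_ell2_coord:
  assumes "x \<in> carrier ell2" "y \<in> carrier ell2"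
  shows "cmod (x k - y k) \<le> hdist ell2 x y"
  using assms cmod_le_hnorm_ell2[of "\<lambda>k. x k - y k" k]
  by (simp add: hdist_def ell2_diff carrier_ell2_diff)

lemma hnorm_ell2_le:
  assumes "0 \<le> c" "\<And>n. (\<Sum>k<n. (cmod (x k))\<^sup>2) \<le> c\<^sup>2"
  shows "x \<in> carrier ell2" "hnorm ell2 x \<le> c"
proof -
  show *: "x \<in> carrier ell2"
    unfolding carrier_ell2 by (rule summableI_nonneg_bounded[OF _ assms(2)]) simp
  then have "(\<Sum>k. (cmod (x k))\<^sup>2) \<le> c\<^sup>2"
    using assms(2) by (intro suminf_le_const) (auto simp: carrier_ell2)
  then show "hnorm ell2 x \<le> c"
    using * assms(1) by (simp add: hnorm_ell2 real_le_lsqrt)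
qed

lemma sum_le_hnorm_ell2:
  assumes "x \<in> carrier ell2" "finite T"
  shows "(\<Sum>k\<in>T. (cmod (x k))\<^sup>2) \<le> (hnorm ell2 x)\<^sup>2"
  using assms sum_le_suminf[of "\<lambda>k. (cmod (x k))\<^sup>2" T]
  by (simp add: ell2.hnorm_power2 inprod_ell2_self carrier_ell2)

lemma mcomplete_ell2: "ell2.mcomplete"
  unfolding ell2.mcomplete_def
proof (intro allI impI)
  fix s :: "nat \<Rightarrow> nat \<Rightarrow> complex"
  assume s: "ell2.MCauchy s"
  then have s_in: "s n \<in> carrier ell2" for n
    by (auto simp: ell2.MCauchy_def)
  have "Cauchy (\<lambda>n. s n k)" for k
  proof (rule CauchyI)
    fix e :: real assume "0 < e"
    then obtain N where N: "\<And>m n. N \<le> m \<Longrightarrow> N \<le> n \<Longrightarrow> hdist ell2 (s m) (s n) < e"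
      using s unfolding ell2.MCauchy_def by blast
    show "\<exists>M. \<forall>m\<ge>M. \<forall>n\<ge>M. norm (s m k - s n k) < e"
      by (rule exI[of _ N]) (use N hdist_ell2_coord s_in in \<open>meson le_less_trans\<close>)
  qed
  then have "\<exists>l. (\<lambda>n. s n k) \<longlonglongrightarrow> l" for k
    by (simp add: Cauchy_convergent_iff convergent_def)
  then obtain l where l: "\<And>k. (\<lambda>n. s n k) \<longlonglongrightarrow> l k" by metis
  have close: "\<exists>N. \<forall>m\<ge>N. l \<in> carrier ell2 \<and> hdist ell2 (s m) l \<le> e" if e: "0 < e" for e
  proof -
    obtain N where N: "\<And>m n. N \<le> m \<Longrightarrow> N \<le> n \<Longrightarrow> hdist ell2 (s m) (s n) < e"
      using s e unfolding ell2.MCauchy_def by blast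
    have "l \<in> carrier ell2 \<and> hdist ell2 (s m) l \<le> e" if m: "N \<le> m" for m
    proof -
      have "(\<Sum>k<K. (cmod (s m k - l k))\<^sup>2) \<le> e\<^sup>2" for K
      proof (rule tendsto_upperbound)
        show "(\<lambda>n. \<Sum>k<K. (cmod (s m k - s n k))\<^sup>2) \<longlonglongrightarrow> (\<Sum>k<K. (cmod (s m k - l k))\<^sup>2)"
          by (intro tendsto_intros l)
        have "(\<Sum>k<K. (cmod (s m k - s n k))\<^sup>2) \<le> e\<^sup>2" if n: "N \<le> n" for n
        proof -
          have "(\<Sum>k<K. (cmod (s m k - s n k))\<^sup>2) \<le> (hdist ell2 (s m) (s n))\<^sup>2"
            using sum_le_hnorm_ell2[OF carrier_ell2_diff[OF s_in[of m] s_in[of n]], of "{..<K}"] s_in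
            by (simp add: hdist_def ell2_diff)
          also have "\<dots> \<le> e\<^sup>2"
            using N[OF m n] by (intro power_mono) auto
          finally show ?thesis .
        qed
        then show "\<forall>\<^sub>F n in sequentially. (\<Sum>k<K. (cmod (s m k - s n k))\<^sup>2) \<le> e\<^sup>2"
          unfolding eventually_sequentially by blast
      qed simp
      from hnorm_ell2_le[OF less_imp_le[OF e] this]
      have d: "(\<lambda>k. s m k - l k) \<in> carrier ell2" "hnorm ell2 (\<lambda>k. s m k - l k) \<le> e" by auto
      have "l \<in> carrier ell2"
        using carrier_ell2_diff[OF s_in[of m] d(1)] by simp
      then show ?thesis
        using d s_in by (simp add: hdist_def ell2_diff)
    qed
    then show ?thesis by blast
  qed
  have "limitin ell2.mtopology s l sequentially"
    unfolding ell2.limitin_metric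
  proof (intro conjI allI impI)
    show "l \<in> carrier ell2" using close[of 1] by auto
    fix e :: real assume "0 < e"
    then obtain N where "\<forall>m\<ge>N. hdist ell2 (s m) l \<le> e / 2"
      using close[of "e / 2"] by auto
    then show "\<forall>\<^sub>F n in sequentially. s n \<in> carrier ell2 \<and> hdist ell2 (s n) l < e"
      unfolding eventually_sequentially using s_in \<open>0 < e\<close> by (intro exI[of _ N]) fastforce
  qed
  then show "\<exists>l. limitin ell2.mtopology s l sequentially"
    by (intro exI[of _ l])
qed

interpretation ell2: complex_hilbert_space ell2
  by unfold_locales (rule mcomplete_ell2)

lemma hdist_ell2_le_head_tail:
  assumes x: "x \<in> carrier ell2" and y: "y \<in> carrier ell2"
    and d: "\<And>k. k < N \<Longrightarrow> cmod (x k - y k) \<le> d"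
    and tx: "\<And>n. (\<Sum>k\<in>{N..<n}. (cmod (x k))\<^sup>2) \<le> t"
    and ty: "\<And>n. (\<Sum>k\<in>{N..<n}. (cmod (y k))\<^sup>2) \<le> t"
  shows "(hdist ell2 x y)\<^sup>2 \<le> real N * d\<^sup>2 + 4 * t"
proof -
  have "(\<Sum>k<n. (cmod (x k - y k))\<^sup>2) \<le> real N * d\<^sup>2 + 4 * t" for n
  proof -
    have "(\<Sum>k<n. (cmod (x k - y k))\<^sup>2) \<le> (\<Sum>k\<in>{..<N} \<union> {N..<n}. (cmod (x k - y k))\<^sup>2)"
      by (rule sum_mono2) auto
    also have "\<dots> = (\<Sum>k<N. (cmod (x k - y k))\<^sup>2) + (\<Sum>k\<in>{N..<n}. (cmod (x k - y k))\<^sup>2)"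
      by (rule sum.union_disjoint) auto
    also have "(\<Sum>k<N. (cmod (x k - y k))\<^sup>2) \<le> (\<Sum>k<N. d\<^sup>2)"
      using d by (intro sum_mono power_mono) auto
    also have "(\<Sum>k\<in>{N..<n}. (cmod (x k - y k))\<^sup>2)
      \<le> (\<Sum>k\<in>{N..<n}. 2 * (cmod (x k))\<^sup>2 + 2 * (cmod (y k))\<^sup>2)"
    proof (rule sum_mono)
      fix k
      have "(cmod (x k - y k))\<^sup>2 \<le> (cmod (x k) + cmod (y k))\<^sup>2"
        by (intro power_mono norm_triangle_ineq4) auto
      also have "\<dots> \<le> 2 * (cmod (x k))\<^sup>2 + 2 * (cmod (y k))\<^sup>2"
        using sum_squares_bound[of "cmod (x k)" "cmod (y k)"] by (simp add: power2_sum)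
      finally show "(cmod (x k - y k))\<^sup>2 \<le> 2 * (cmod (x k))\<^sup>2 + 2 * (cmod (y k))\<^sup>2" .
    qed
    also have "\<dots> \<le> 2 * t + 2 * t"
      using tx[of n] ty[of n] by (simp add: sum.distrib flip: sum_distrib_left)
    finally show ?thesis by simp
  qed
  then have "(\<Sum>k. (cmod (x k - y k))\<^sup>2) \<le> real N * d\<^sup>2 + 4 * t"
    using carrier_ell2_diff[OF x y] by (intro suminf_le_const) (auto simp: carrier_ell2)
  moreover have "0 \<le> (\<Sum>k. (cmod (x k - y k))\<^sup>2)"
    using carrier_ell2_diff[OF x y] by (intro suminf_nonneg) (auto simp: carrier_ell2)
  ultimately show ?thesis
    using x y by (simp add: hdist_ell2)
qed

lemma exists_small_head:
  fixes e :: real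
  assumes "0 < e"
  obtains d where "0 < d" "real N * d\<^sup>2 < e"
proof -
  have "((\<lambda>d. real N * d\<^sup>2) \<longlongrightarrow> real N * 0\<^sup>2) (at_right 0)"
    by (intro tendsto_intros)
  then have "\<forall>\<^sub>F d in at_right 0. real N * d\<^sup>2 < e"
    using assms by (intro order_tendstoD) auto
  with eventually_at_right_less[of 0] have "\<forall>\<^sub>F d in at_right 0. 0 < d \<and> real N * d\<^sup>2 < e"
    by eventually_elim auto
  then show ?thesis
    using that eventually_happens' trivial_limit_at_right_real by blast
qed

lemma continuous_map_ell2I:
  assumes f: "f \<in> topspace T \<rightarrow> carrier ell2"
    and coord: "\<And>k. continuous_map T euclidean (\<lambda>x. f x k)"
    and tail: "\<And>x0 t. x0 \<in> topspace T \<Longrightarrow> 0 < t \<Longrightarrow>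
      \<exists>U N. openin T U \<and> x0 \<in> U \<and> (\<forall>x\<in>U. \<forall>n. (\<Sum>k\<in>{N..<n}. (cmod (f x k))\<^sup>2) \<le> t)"
  shows "continuous_map T (htopology ell2) f"
  unfolding ell2.continuous_map_to_metric
proof (intro ballI allI impI)
  fix x0 and e :: real
  assume x0: "x0 \<in> topspace T" and e: "0 < e"
  obtain U N where U: "openin T U" "x0 \<in> U"
    and t: "\<And>x n. x \<in> U \<Longrightarrow> (\<Sum>k\<in>{N..<n}. (cmod (f x k))\<^sup>2) \<le> e\<^sup>2 / 8"
    using tail[OF x0, of "e\<^sup>2 / 8"] e by auto
  obtain d where d: "0 < d" "real N * d\<^sup>2 < e\<^sup>2 / 2"
    using exists_small_head[of "e\<^sup>2 / 2" N] e by auto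
  define V where "V = U \<inter> (\<Inter>k<N. {x \<in> topspace T. f x k \<in> ball (f x0 k) d}) \<inter> topspace T"
  have "openin T V"
  proof (cases "N = 0")
    case True
    then show ?thesis using U by (auto simp: V_def intro: openin_Int)
  next
    case False
    have "openin T {x \<in> topspace T. f x k \<in> ball (f x0 k) d}" for k
      using coord[of k] by (intro openin_continuous_map_preimage) auto
    then show ?thesis
      using U False unfolding V_def by (intro openin_Int openin_INT2 openin_topspace) auto
  qed
  moreover have "x0 \<in> V"
    using U x0 d by (auto simp: V_def)
  moreover have "f x \<in> ell2.mball (f x0) e" if "x \<in> V" for x
  proof -
    have in_ell2: "f x \<in> carrier ell2" "f x0 \<in> carrier ell2"
      using that x0 f by (auto simp: V_def)
    have "(hdist ell2 (f x0) (f x))\<^sup>2 \<le> real N * d\<^sup>2 + 4 * (e\<^sup>2 / 8)"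
      by (rule hdist_ell2_le_head_tail)
        (use in_ell2 t that U in \<open>auto simp: V_def dist_norm intro: less_imp_le\<close>)
    also have "\<dots> < e\<^sup>2" using d by simp
    finally have "hdist ell2 (f x0) (f x) < e"
      using e by (simp add: power2_less_imp_less)
    then show ?thesis using in_ell2 by simp
  qed
  ultimately show "\<exists>U. openin T U \<and> x0 \<in> U \<and> (\<forall>x\<in>U. f x \<in> ell2.mball (f x0) e)"
    by blast
qed

lemma ell2_tail_small:
  assumes "x \<in> carrier ell2" "0 < t"
  obtains N where "\<And>n. (\<Sum>k\<in>{N..<n}. (cmod (x k))\<^sup>2) \<le> t"
proof -
  have s: "summable (\<lambda>k. (cmod (x k))\<^sup>2)" using assms by (simp add: carrier_ell2)
  from summable_partial_sum_bound[OF this assms(2)]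
  obtain N where N: "\<And>m n. N \<le> m \<Longrightarrow> norm (\<Sum>k=m..n. (cmod (x k))\<^sup>2) < t" by blast
  have "(\<Sum>k\<in>{N..<n}. (cmod (x k))\<^sup>2) \<le> t" for n
  proof -
    have "(\<Sum>k\<in>{N..<n}. (cmod (x k))\<^sup>2) \<le> (\<Sum>k=N..n. (cmod (x k))\<^sup>2)"
      by (rule sum_mono2) auto
    also have "\<dots> \<le> norm (\<Sum>k=N..n. (cmod (x k))\<^sup>2)" by simp
    also have "\<dots> < t" by (rule N) simp
    finally show ?thesis by simp
  qed
  then show ?thesis using that by blast
qed

lemma separable_ell2: "separable_space (htopology ell2)"
proof -
  obtain D :: "complex set" where D: "countable D" "\<And>X. open X \<Longrightarrow> X \<noteq> {} \<Longrightarrow> \<exists>d\<in>D. d \<in> X"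
    using countable_dense_setE by blast
  define E where "E = (\<lambda>l k. if k < length l then l ! k else 0) ` lists D"
  have "countable E"
    using D(1) unfolding E_def by (intro countable_image countable_lists)
  moreover have "(\<lambda>k. if k < length l then l ! k else 0) \<in> carrier ell2" for l
    by (rule carrier_ell2_finite_support[of "{..<length l}"]) auto
  then have E: "E \<subseteq> carrier ell2"
    by (auto simp: E_def)
  moreover have "\<exists>y\<in>E. y \<in> ell2.mball x r" if x: "x \<in> carrier ell2" and r: "0 < r" for x r
  proof -
    obtain N where N: "\<And>n. (\<Sum>k\<in>{N..<n}. (cmod (x k))\<^sup>2) \<le> r\<^sup>2 / 8"
      using ell2_tail_small[OF x, of "r\<^sup>2 / 8"] r by auto
    obtain d where d: "0 < d" "real N * d\<^sup>2 < r\<^sup>2 / 2"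
      using exists_small_head[of "r\<^sup>2 / 2" N] r by auto
    have "\<exists>q\<in>D. q \<in> ball (x k) d" for k
      using D(2)[of "ball (x k) d"] d by auto
    then obtain q where q: "\<And>k. q k \<in> D" "\<And>k. cmod (x k - q k) < d"
      by (metis dist_norm mem_ball)
    define y where "y = (\<lambda>k. if k < N then q k else 0)"
    have "y = (\<lambda>k. if k < length (map q [0..<N]) then map q [0..<N] ! k else 0)"
      by (auto simp: y_def fun_eq_iff)
    then have y: "y \<in> E"
      unfolding E_def using q by (intro image_eqI[of _ _ "map q [0..<N]"]) auto
    have "(hdist ell2 x y)\<^sup>2 \<le> real N * d\<^sup>2 + 4 * (r\<^sup>2 / 8)"
      by (rule hdist_ell2_le_head_tail)
        (use x y E N q in \<open>auto simp: y_def intro: less_imp_le\<close>)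
    also have "\<dots> < r\<^sup>2" using d by simp
    finally have "hdist ell2 x y < r"
      using r by (simp add: power2_less_imp_less)
    then show ?thesis using x y E by auto
  qed
  ultimately show ?thesis
    unfolding separable_space_def using E
    by (intro exI[of _ E]) (auto simp: ell2.metric_closure_of)
qed

lemma compactin_ell2_box:
  assumes "summable (\<lambda>k. (s k)\<^sup>2)"
  shows "compactin (htopology ell2) {x. \<forall>k. cmod (x k) \<le> s k}"
proof -
  let ?K = "{x. \<forall>k. cmod (x k) \<le> s k}"
  have K: "?K = (\<Pi>\<^sub>E k\<in>UNIV. cball 0 (s k))" by (auto simp: PiE_def Pi_def)
  have "compactin (product_topology (\<lambda>_. euclidean) UNIV) ?K"
    unfolding K by (subst compactin_PiE) auto
  then have "compactin euclidean ?K" by (simp add: euclidean_product_topology)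
  then have "compactin (top_of_set ?K) ?K" by (simp add: compactin_subtopology)
  moreover have "continuous_map (top_of_set ?K) (htopology ell2) (\<lambda>x. x)"
  proof (rule continuous_map_ell2I)
    show "(\<lambda>x. x) \<in> topspace (top_of_set ?K) \<rightarrow> carrier ell2"
      using carrier_ell2_dominated[OF assms] by auto
    show "continuous_map (top_of_set ?K) euclidean (\<lambda>x. x k)" for k
      by (auto intro: continuous_on_product_coordinates continuous_on_subset)
    fix x0 :: "nat \<Rightarrow> complex" and t :: real assume x0: "x0 \<in> topspace (top_of_set ?K)" and t: "0 < t"
    have "(\<lambda>k. complex_of_real (s k)) \<in> carrier ell2"
      using assms by (simp add: carrier_ell2)
    then obtain N where N: "\<And>n. (\<Sum>k\<in>{N..<n}. (cmod (s k))\<^sup>2) \<le> t"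
      using ell2_tail_small[OF _ t, of "\<lambda>k. complex_of_real (s k)"] by metis
    have "(\<Sum>k\<in>{N..<n}. (cmod (x k))\<^sup>2) \<le> t" if "x \<in> ?K" for x n
    proof -
      have "(\<Sum>k\<in>{N..<n}. (cmod (x k))\<^sup>2) \<le> (\<Sum>k\<in>{N..<n}. (cmod (s k))\<^sup>2)"
        using that power_mono[of "cmod (x _)" "s _" 2] by (intro sum_mono) auto
      then show ?thesis using N[of n] by simp
    qed
    then show "\<exists>U N. openin (top_of_set ?K) U \<and> x0 \<in> U \<and>
        (\<forall>x\<in>U. \<forall>n. (\<Sum>k\<in>{N..<n}. (cmod (x k))\<^sup>2) \<le> t)"
      using x0 by (intro exI[of _ ?K] exI[of _ N]) (auto simp: openin_subtopology_self)
  qed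
  ultimately have "compactin (htopology ell2) ((\<lambda>x. x) ` ?K)"
    by (rule image_compactin)
  then show ?thesis by simp
qed

lemma finsum_ell2:
  assumes "finite B" "f \<in> B \<rightarrow> carrier ell2"
  shows "finsum ell2 f B = (\<lambda>k. \<Sum>b\<in>B. f b k)"
  using assms
proof (induction B rule: finite_induct)
  case (insert b B)
  then show ?case
    using ell2.finsum_insert[of B b f] by (auto simp: Pi_def)
qed simp

section \<open>Products along binary expansions\<close>

text \<open>
  The last \<open>J\<close> binary digits of \<open>k\<close> select one factor from each of the first \<open>J\<close> pairs of variables;
  the last digit belongs to the pair \<open>J - 1\<close>.
\<close>

primrec path_prod :: "(nat \<Rightarrow> 'a::comm_monoid_mult) \<Rightarrow> nat \<Rightarrow> nat \<Rightarrow> 'a" where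
  "path_prod x 0 k = 1"
| "path_prod x (Suc J) k = path_prod x J (k div 2) * x (2 * J + k mod 2)"

text \<open>As \<open>floor_log 0 = 0\<close>, coordinate \<open>0\<close> is the constant \<open>1\<close>, just like coordinate \<open>1\<close>.\<close>

definition monom_map :: "(nat \<Rightarrow> 'a::comm_monoid_mult) \<Rightarrow> nat \<Rightarrow> 'a"
  where "monom_map x k = path_prod x (floor_log k) k"

lemma sum_double_interval:
  "(\<Sum>k\<in>{2 * a..<2 * b}. F k) = (\<Sum>k\<in>{a..<b}. F (2 * k) + F (2 * k + 1))"
  for F :: "nat \<Rightarrow> 'a::comm_monoid_add"
proof (induction b)
  case (Suc b)
  show ?case
  proof (cases "a \<le> b")
    case True
    then have "{2 * a..<2 * Suc b} = insert (2 * b + 1) (insert (2 * b) {2 * a..<2 * b})"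
      by auto
    then show ?thesis using Suc True by (simp add: add_ac)
  qed auto
qed auto

lemma norm_path_prod:
  "norm (path_prod x J k) = path_prod (\<lambda>j. norm (x j)) J k"
  for x :: "nat \<Rightarrow> 'a::{real_normed_div_algebra,comm_monoid_mult}"
  by (induction J arbitrary: k) (auto simp: norm_mult)

lemma path_prod_nonneg:
  fixes g :: "nat \<Rightarrow> real"
  shows "(\<And>j. 0 \<le> g j) \<Longrightarrow> 0 \<le> path_prod g J k"
  by (induction J arbitrary: k) auto

lemma path_prod_mono:
  fixes g h :: "nat \<Rightarrow> real"
  assumes "\<And>j. 0 \<le> g j" "\<And>j. g j \<le> h j"
  shows "path_prod g J k \<le> path_prod h J k"
  by (induction J arbitrary: k)
    (auto intro!: mult_mono assms path_prod_nonneg intro: order_trans[OF assms])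

lemma sum_path_prod_block:
  fixes g :: "nat \<Rightarrow> real"
  shows "(\<Sum>k\<in>{2^J..<2^Suc J}. (path_prod g J k)\<^sup>2) = (\<Prod>j<J. (g (2*j))\<^sup>2 + (g (2*j+1))\<^sup>2)"
proof (induction J)
  case (Suc J)
  have "(\<Sum>k\<in>{2^Suc J..<2^Suc (Suc J)}. (path_prod g (Suc J) k)\<^sup>2)
    = (\<Sum>k\<in>{2^J..<2^Suc J}. (path_prod g (Suc J) (2*k))\<^sup>2 + (path_prod g (Suc J) (2*k+1))\<^sup>2)"
    using sum_double_interval[of "\<lambda>k. (path_prod g (Suc J) k)\<^sup>2" "2^J" "2^Suc J"] by simp
  also have "\<dots> = (\<Sum>k\<in>{2^J..<2^Suc J}. (path_prod g J k)\<^sup>2 * ((g (2*J))\<^sup>2 + (g (2*J+1))\<^sup>2))"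
    by (simp add: power_mult_distrib distrib_left)
  also have "\<dots> = (\<Prod>j<Suc J. (g (2*j))\<^sup>2 + (g (2*j+1))\<^sup>2)"
    using Suc by (simp flip: sum_distrib_right)
  finally show ?case .
qed simp

lemma power_Suc_add_ge:
  fixes a b :: real
  assumes "0 \<le> a" "0 \<le> b"
  shows "a ^ Suc n + real (Suc n) * b * a ^ n \<le> (a + b) ^ Suc n"
proof (induction n)
  case (Suc n)
  have "a ^ Suc (Suc n) + real (Suc (Suc n)) * b * a ^ Suc n
    \<le> (a ^ Suc n + real (Suc n) * b * a ^ n) * (a + b)"
    using assms by (simp add: algebra_simps)
  also have "\<dots> \<le> (a + b) ^ Suc n * (a + b)"
    using Suc assms by (intro mult_right_mono) auto
  finally show ?case by (simp add: mult_ac)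
qed simp

lemma prod_mult_fact_le_sum_power:
  fixes p :: "nat \<Rightarrow> real"
  assumes "\<And>j. 0 \<le> p j"
  shows "(\<Prod>j<J. p j) * fact J \<le> (\<Sum>j<J. p j) ^ J"
proof (induction J)
  case (Suc J)
  define S where "S = (\<Sum>j<J. p j)"
  have S: "0 \<le> S" using assms by (auto simp: S_def intro: sum_nonneg)
  have "(\<Prod>j<Suc J. p j) * fact (Suc J) = real (Suc J) * p J * ((\<Prod>j<J. p j) * fact J)"
    by simp
  also have "\<dots> \<le> real (Suc J) * p J * S ^ J"
    using Suc assms by (intro mult_left_mono) (auto simp: S_def)
  also have "\<dots> \<le> (S + p J) ^ Suc J"
    using power_Suc_add_ge[of S "p J" J] S assms[of J] zero_le_power[OF S, of "Suc J"] by linarith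
  finally show ?case by (simp add: S_def)
qed simp

definition exp_tail :: "real \<Rightarrow> nat \<Rightarrow> real"
  where "exp_tail R N = (\<Sum>J. R ^ (J + N) / fact (J + N))"

lemma summable_exp_tail: "summable (\<lambda>J. R ^ (J + N) / fact (J + N))" for R :: real
  using summable_exp_generic[of R, THEN summable_ignore_initial_segment, of N]
  by (simp add: divide_inverse mult.commute)

lemma exp_tail_tendsto_0: "exp_tail R \<longlonglongrightarrow> 0"
proof -
  have "exp_tail R = (\<lambda>N. exp_tail R 0 - (\<Sum>J<N. R ^ J / fact J))"
  proof
    fix N
    show "exp_tail R N = exp_tail R 0 - (\<Sum>J<N. R ^ J / fact J)"
      using suminf_split_initial_segment[OF summable_exp_tail[of R 0], of N]
      by (simp add: exp_tail_def)
  qed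
  moreover have "(\<lambda>N. \<Sum>J<N. R ^ J / fact J) \<longlonglongrightarrow> exp_tail R 0"
    using summable_LIMSEQ[OF summable_exp_tail[of R 0]] by (simp add: exp_tail_def)
  then have "(\<lambda>N. exp_tail R 0 - (\<Sum>J<N. R ^ J / fact J)) \<longlonglongrightarrow> exp_tail R 0 - exp_tail R 0"
    by (intro tendsto_intros)
  ultimately show ?thesis by simp
qed

lemma monom_map_block:
  assumes "k \<in> {2^J..<2^Suc J}"
  shows "monom_map x k = path_prod x J k"
proof -
  have "0 < k" using assms by (auto intro: less_le_trans[of 0 "2^J"])
  then have "floor_log k = J"
    using assms by (intro floor_log_eqI) auto
  then show ?thesis by (simp add: monom_map_def)
qed

lemma monom_map_tail_bound:
  fixes g :: "nat \<Rightarrow> real"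
  assumes R: "\<And>n. (\<Sum>k<n. (g k)\<^sup>2) \<le> R"
  shows "(\<Sum>k\<in>{2^N..<n}. (monom_map g k)\<^sup>2) \<le> exp_tail R N"
proof -
  have "0 \<le> R" using R[of 0] by simp
  have block: "(\<Sum>k\<in>{2^J..<2^Suc J}. (monom_map g k)\<^sup>2) \<le> R ^ J / fact J" for J
  proof -
    have pairs: "(\<Sum>j<J. (g (2*j))\<^sup>2 + (g (2*j+1))\<^sup>2) = (\<Sum>k<2*J. (g k)\<^sup>2)"
      using sum_double_interval[of "\<lambda>k. (g k)\<^sup>2" 0 J] by (simp add: lessThan_atLeast0)
    have "(\<Sum>k\<in>{2^J..<2^Suc J}. (monom_map g k)\<^sup>2)
      = (\<Prod>j<J. (g (2*j))\<^sup>2 + (g (2*j+1))\<^sup>2)"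
      unfolding sum_path_prod_block[symmetric] by (intro sum.cong refl) (simp only: monom_map_block)
    also have "\<dots> \<le> (\<Sum>k<2*J. (g k)\<^sup>2) ^ J / fact J"
      using prod_mult_fact_le_sum_power[of "\<lambda>j. (g (2*j))\<^sup>2 + (g (2*j+1))\<^sup>2" J]
      unfolding pairs by (simp add: field_simps)
    also have "\<dots> \<le> R ^ J / fact J"
      using R[of "2 * J"] by (intro divide_right_mono power_mono) (auto intro: sum_nonneg)
    finally show ?thesis .
  qed
  have "(\<Sum>k\<in>{2^N..<2^(N+M)}. (monom_map g k)\<^sup>2) \<le> (\<Sum>J<M. R ^ (J + N) / fact (J + N))" for M
  proof (induction M)
    case (Suc M)
    have "(\<Sum>k\<in>{2^N..<2^(N+Suc M)}. (monom_map g k)\<^sup>2)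
      = (\<Sum>k\<in>{2^N..<2^(N+M)}. (monom_map g k)\<^sup>2)
        + (\<Sum>k\<in>{2^(N+M)..<2^Suc (N+M)}. (monom_map g k)\<^sup>2)"
      by (subst sum.atLeastLessThan_concat) (auto intro: power_increasing)
    then show ?case using Suc block[of "N + M"] by (simp add: add.commute)
  qed simp
  note this[of n]
  also have "(\<Sum>J<n. R ^ (J + N) / fact (J + N)) \<le> exp_tail R N"
    unfolding exp_tail_def using \<open>0 \<le> R\<close> by (intro sum_le_suminf summable_exp_tail) auto
  finally have *: "(\<Sum>k\<in>{2^N..<2^(N+n)}. (monom_map g k)\<^sup>2) \<le> exp_tail R N" .
  have "n \<le> 2 ^ (N + n)"
    using less_exp[of "N + n"] by linarith
  then have "(\<Sum>k\<in>{2^N..<n}. (monom_map g k)\<^sup>2) \<le> (\<Sum>k\<in>{2^N..<2^(N+n)}. (monom_map g k)\<^sup>2)"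
    by (intro sum_mono2) auto
  with * show ?thesis by linarith
qed

text \<open>
  The part of \<open>path_prod (\<lambda>j. a j + h j) J k\<close> that is homogeneous of degree \<open>m\<close> in \<open>h\<close>, polarized: the
  \<open>l\<close>-th factor that is taken from \<open>h\<close> is taken from \<open>h l\<close>.
\<close>

primrec taylor_coord ::
  "(nat \<Rightarrow> complex) \<Rightarrow> (nat \<Rightarrow> nat \<Rightarrow> complex) \<Rightarrow> nat \<Rightarrow> nat \<Rightarrow> nat \<Rightarrow> complex" where
  "taylor_coord a h 0 m k = (if m = 0 then 1 else 0)"
| "taylor_coord a h (Suc J) m k =
    taylor_coord a h J m (k div 2) * a (2 * J + k mod 2) +
    (if m = 0 then 0 else taylor_coord a h J (m - 1) (k div 2) * h (m - 1) (2 * J + k mod 2))"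

lemma taylor_coord_0: "taylor_coord a h J 0 k = path_prod a J k"
  by (induction J arbitrary: k) auto

lemma taylor_coord_cong:
  "(\<And>l. l < m \<Longrightarrow> h l = h' l) \<Longrightarrow> taylor_coord a h J m k = taylor_coord a h' J m k"
  by (induction J arbitrary: k m) auto

lemma taylor_coord_add:
  assumes "i < m"
  shows "taylor_coord a (h(i := \<lambda>j. s j + t j)) J m k =
    taylor_coord a (h(i := s)) J m k + taylor_coord a (h(i := t)) J m k"
  using assms
proof (induction J arbitrary: k m)
  case (Suc J)
  obtain n where n: "m = Suc n" using Suc.prems by (cases m) auto
  have indep: "taylor_coord a (h(n := v)) J n (k div 2) = taylor_coord a h J n (k div 2)" for v
    by (intro taylor_coord_cong) auto
  show ?case
    using Suc.IH[of m "k div 2"] Suc.IH[of n "k div 2"] Suc.prems indep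
    by (cases "i = n") (auto simp: n algebra_simps simp del: fun_upd_apply simp: fun_upd_same fun_upd_other)
qed auto

lemma taylor_coord_smult:
  assumes "i < m"
  shows "taylor_coord a (h(i := \<lambda>j. c * s j)) J m k = c * taylor_coord a (h(i := s)) J m k"
  using assms
proof (induction J arbitrary: k m)
  case (Suc J)
  obtain n where n: "m = Suc n" using Suc.prems by (cases m) auto
  have indep: "taylor_coord a (h(n := v)) J n (k div 2) = taylor_coord a h J n (k div 2)" for v
    by (intro taylor_coord_cong) auto
  show ?case
    using Suc.IH[of m "k div 2"] Suc.IH[of n "k div 2"] Suc.prems indep
    by (cases "i = n") (auto simp: n algebra_simps simp del: fun_upd_apply simp: fun_upd_same fun_upd_other)
qed auto

lemma norm_taylor_coord_le:
  "cmod (taylor_coord a h J m k) \<le> path_prod (\<lambda>j. cmod (a j) + (\<Sum>l<m. cmod (h l j))) J k"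
proof (induction J arbitrary: k m)
  case (Suc J)
  define i where "i = 2 * J + k mod 2"
  let ?G = "\<lambda>m j. cmod (a j) + (\<Sum>l<m. cmod (h l j))"
  have G: "0 \<le> ?G n j" for n j by (simp add: sum_nonneg)
  show ?case
  proof (cases m)
    case 0
    then show ?thesis using Suc[of 0] by (simp add: norm_mult mult_right_mono)
  next
    case (Suc n)
    have le: "?G n j \<le> ?G m j" for j using Suc by simp
    have nonneg: "0 \<le> path_prod (?G m) J (k div 2)" by (rule path_prod_nonneg) (rule G)
    have "cmod (taylor_coord a h (Suc J) m k) \<le>
      cmod (taylor_coord a h J m (k div 2)) * cmod (a i) +
      cmod (taylor_coord a h J n (k div 2)) * cmod (h n i)"
      using Suc norm_triangle_ineq[of "taylor_coord a h J m (k div 2) * a i"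
          "taylor_coord a h J n (k div 2) * h n i"]
      by (simp add: i_def norm_mult)
    also have "\<dots> \<le> path_prod (?G m) J (k div 2) * cmod (a i) + path_prod (?G m) J (k div 2) * cmod (h n i)"
      using Suc.IH[of m "k div 2"] order_trans[OF Suc.IH[of n "k div 2"] path_prod_mono[OF G le]]
      by (intro add_mono mult_right_mono) auto
    also have "\<dots> = path_prod (?G m) J (k div 2) * (cmod (a i) + cmod (h n i))"
      by (simp add: distrib_left)
    also have "\<dots> \<le> path_prod (?G m) J (k div 2) * ?G m i"
      using Suc nonneg by (intro mult_left_mono) (auto intro: sum_nonneg)
    finally show ?thesis by (simp add: i_def)
  qed
qed simp

lemma norm_taylor_coord_diagonal_le:
  "(\<Sum>m<M. cmod (taylor_coord a (\<lambda>_. h) J m k)) \<le> path_prod (\<lambda>j. cmod (a j) + cmod (h j)) J k"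
proof (induction J arbitrary: k M)
  case 0
  then show ?case by (cases M) (simp_all add: sum.lessThan_Suc_shift del: sum.lessThan_Suc)
next
  case (Suc J)
  define i where "i = 2 * J + k mod 2"
  let ?t = "\<lambda>m. cmod (taylor_coord a (\<lambda>_. h) J m (k div 2))"
  have "(\<Sum>m<M. cmod (taylor_coord a (\<lambda>_. h) (Suc J) m k))
    \<le> (\<Sum>m<M. ?t m * cmod (a i) + (if m = 0 then 0 else ?t (m - 1) * cmod (h i)))"
    by (intro sum_mono) (auto simp: i_def norm_mult intro!: norm_triangle_le)
  also have "\<dots> = (\<Sum>m<M. ?t m) * cmod (a i) + (\<Sum>m<M - 1. ?t m) * cmod (h i)"
  proof (cases M)
    case (Suc n)
    have "(\<Sum>m<M. if m = 0 then 0 else ?t (m - 1) * cmod (h i)) = (\<Sum>m<n. ?t m * cmod (h i))"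
      by (simp add: Suc sum.lessThan_Suc_shift del: sum.lessThan_Suc)
    then show ?thesis using Suc by (simp only: sum.distrib sum_distrib_right diff_Suc_1)
  qed simp
  also have "\<dots> \<le> path_prod (\<lambda>j. cmod (a j) + cmod (h j)) J (k div 2) * cmod (a i)
      + path_prod (\<lambda>j. cmod (a j) + cmod (h j)) J (k div 2) * cmod (h i)"
    using Suc by (intro add_mono mult_right_mono) auto
  finally show ?case by (simp add: i_def distrib_left)
qed

lemma sum_taylor_coord:
  "J \<le> N \<Longrightarrow> (\<Sum>m\<le>N. taylor_coord a (\<lambda>_. h) J m k) = path_prod (\<lambda>j. a j + h j) J k"
proof (induction J arbitrary: k N)
  case 0
  then show ?case by (cases N) (simp_all add: sum.atMost_Suc_shift del: sum.atMost_Suc)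
next
  case (Suc J)
  define i where "i = 2 * J + k mod 2"
  let ?t = "\<lambda>m. taylor_coord a (\<lambda>_. h) J m (k div 2)"
  obtain M where M: "N = Suc M" "J \<le> M" using Suc.prems by (cases N) auto
  have "(\<Sum>m\<le>N. taylor_coord a (\<lambda>_. h) (Suc J) m k)
    = (\<Sum>m\<le>N. ?t m * a i) + (\<Sum>m\<le>N. if m = 0 then 0 else ?t (m - 1) * h i)"
    by (simp only: i_def sum.distrib taylor_coord.simps)
  also have "(\<Sum>m\<le>N. if m = 0 then 0 else ?t (m - 1) * h i) = (\<Sum>m\<le>M. ?t m * h i)"
    by (simp add: M sum.atMost_Suc_shift del: sum.atMost_Suc)
  also have "(\<Sum>m\<le>N. ?t m * a i) + (\<Sum>m\<le>M. ?t m * h i)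
    = path_prod (\<lambda>j. a j + h j) J (k div 2) * (a i + h i)"
    using Suc.IH[of N] Suc.IH[of M] M by (simp add: distrib_left flip: sum_distrib_right)
  finally show ?case by (simp add: i_def)
qed

section \<open>Holomorphy of the product map\<close>

lemma norm_monom_map: "cmod (monom_map x k) = monom_map (\<lambda>j. cmod (x j)) k"
  by (simp add: monom_map_def norm_path_prod)

lemma monom_map_dominated_tail:
  assumes "\<And>n. (\<Sum>k<n. (g k)\<^sup>2) \<le> R" "\<And>k. cmod (v k) \<le> monom_map g k"
  shows "(\<Sum>k\<in>{2^N..<n}. (cmod (v k))\<^sup>2) \<le> exp_tail R N"
proof -
  have "(\<Sum>k\<in>{2^N..<n}. (cmod (v k))\<^sup>2) \<le> (\<Sum>k\<in>{2^N..<n}. (monom_map g k)\<^sup>2)"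
    using assms(2) by (intro sum_mono power_mono) auto
  also have "\<dots> \<le> exp_tail R N"
    by (rule monom_map_tail_bound) (rule assms)
  finally show ?thesis .
qed

lemma monom_map_dominated_carrier:
  assumes "\<And>n. (\<Sum>k<n. (g k)\<^sup>2) \<le> R" "\<And>k. cmod (v k) \<le> monom_map g k"
  shows "v \<in> carrier ell2"
  unfolding carrier_ell2
proof (rule summableI_nonneg_bounded)
  fix n
  have "(\<Sum>k<n. (cmod (v k))\<^sup>2) \<le> (\<Sum>k\<in>insert 0 {1..<n}. (cmod (v k))\<^sup>2)"
    by (rule sum_mono2) auto
  also have "\<dots> \<le> (cmod (v 0))\<^sup>2 + exp_tail R 0"
    using monom_map_dominated_tail[OF assms, of 0 n] by simp
  finally show "(\<Sum>k<n. (cmod (v k))\<^sup>2) \<le> (cmod (v 0))\<^sup>2 + exp_tail R 0" .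
qed simp

lemma monom_map_carrier:
  assumes "x \<in> carrier ell2"
  shows "monom_map x \<in> carrier ell2"
  using sum_le_hnorm_ell2[OF assms finite_lessThan]
  by (rule monom_map_dominated_carrier) (simp add: norm_monom_map)

lemma sum_power2_add_le:
  assumes "a \<in> carrier ell2" "h \<in> carrier ell2" "hnorm ell2 h \<le> r"
  shows "(\<Sum>k<n. (cmod (a k) + cmod (h k))\<^sup>2) \<le> 2 * (hnorm ell2 a)\<^sup>2 + 2 * r\<^sup>2"
proof -
  have "(\<Sum>k<n. (cmod (a k) + cmod (h k))\<^sup>2) \<le> (\<Sum>k<n. 2 * (cmod (a k))\<^sup>2 + 2 * (cmod (h k))\<^sup>2)"
  proof (rule sum_mono)
    fix k
    show "(cmod (a k) + cmod (h k))\<^sup>2 \<le> 2 * (cmod (a k))\<^sup>2 + 2 * (cmod (h k))\<^sup>2"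
      using sum_squares_bound[of "cmod (a k)" "cmod (h k)"] by (simp add: power2_sum)
  qed
  also have "\<dots> = 2 * (\<Sum>k<n. (cmod (a k))\<^sup>2) + 2 * (\<Sum>k<n. (cmod (h k))\<^sup>2)"
    by (simp add: sum.distrib sum_distrib_left)
  also have "\<dots> \<le> 2 * (hnorm ell2 a)\<^sup>2 + 2 * (hnorm ell2 h)\<^sup>2"
    using assms by (intro add_mono mult_left_mono sum_le_hnorm_ell2) auto
  also have "(hnorm ell2 h)\<^sup>2 \<le> r\<^sup>2"
    using assms by (intro power_mono ell2.hnorm_nonneg) auto
  finally show ?thesis by simp
qed

definition taylor_form ::
  "(nat \<Rightarrow> complex) \<Rightarrow> nat \<Rightarrow> (nat \<Rightarrow> nat \<Rightarrow> complex) \<Rightarrow> nat \<Rightarrow> complex"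
  where "taylor_form a m h k = taylor_coord a h (floor_log k) m k"

lemma taylor_form_carrier:
  assumes "a \<in> carrier ell2" "\<And>l. l < m \<Longrightarrow> h l \<in> carrier ell2"
  shows "taylor_form a m h \<in> carrier ell2"
proof -
  define g where "g = (\<lambda>j. cmod (a j) + (\<Sum>l<m. cmod (h l j)))"
  have cmod_in: "(\<lambda>j. complex_of_real (cmod (x j))) \<in> carrier ell2" if "x \<in> carrier ell2" for x
    using that by (simp add: carrier_ell2)
  have "(\<lambda>j. \<Sum>l<n. complex_of_real (cmod (h l j))) \<in> carrier ell2" if "n \<le> m" for n
    using that
  proof (induction n)
    case (Suc n)
    then show ?case
      using carrier_ell2_add[OF _ cmod_in[of "h n"]] assms by simp
  qed (simp add: carrier_ell2)
  from carrier_ell2_add[OF cmod_in[OF assms(1)] this[OF order_refl]]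
  have g: "(\<lambda>j. complex_of_real (g j)) \<in> carrier ell2" by (simp add: g_def)
  have "(\<Sum>k<n. (g k)\<^sup>2) \<le> (hnorm ell2 (\<lambda>j. complex_of_real (g j)))\<^sup>2" for n
    using sum_le_hnorm_ell2[OF g finite_lessThan] by simp
  then show ?thesis
    by (rule monom_map_dominated_carrier)
      (simp add: taylor_form_def monom_map_def g_def norm_taylor_coord_le)
qed

lemma multilinear_taylor_form:
  assumes "a \<in> carrier ell2"
  shows "multilinear_between ell2 ell2 m (taylor_form a m)"
  unfolding multilinear_between_def linear_between_def
  using assms
  by (auto intro!: taylor_form_carrier
      simp: taylor_form_def taylor_coord_add taylor_coord_smult fun_eq_iff PiE_def Pi_def
      simp del: fun_upd_apply) (auto split: if_splits)

lemma norm_taylor_form_diagonal_le: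
  "cmod (\<Sum>m<M. taylor_form a m (\<lambda>_. h) k) \<le> monom_map (\<lambda>j. cmod (a j) + cmod (h j)) k"
  using norm_taylor_coord_diagonal_le[of a h "floor_log k" k M]
  by (auto simp: taylor_form_def monom_map_def intro: order_trans[OF norm_sum])

lemma norm_taylor_form_le:
  "cmod (taylor_form a m (\<lambda>_. h) k) \<le> monom_map (\<lambda>j. cmod (a j) + cmod (h j)) k"
proof -
  have "cmod (taylor_form a m (\<lambda>_. h) k) \<le> (\<Sum>i<Suc m. cmod (taylor_form a i (\<lambda>_. h) k))"
    by (rule member_le_sum) auto
  also have "\<dots> \<le> monom_map (\<lambda>j. cmod (a j) + cmod (h j)) k"
    unfolding taylor_form_def monom_map_def by (rule norm_taylor_coord_diagonal_le)
  finally show ?thesis .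
qed

lemma continuous_map_ell2_coord: "continuous_map (htopology ell2) euclidean (\<lambda>x. x k)"
  unfolding ell2.continuous_map_from_metric
proof (intro conjI ballI allI impI)
  fix x :: "nat \<Rightarrow> complex" and U
  assume x: "x \<in> carrier ell2" and U: "openin euclidean U \<and> x k \<in> U"
  then obtain r where r: "0 < r" "ball (x k) r \<subseteq> U" using openE by auto
  show "\<exists>r>0. \<forall>y. y \<in> carrier ell2 \<and> hdist ell2 x y < r \<longrightarrow> y k \<in> U"
  proof (intro exI[of _ r] conjI allI impI)
    fix y assume y: "y \<in> carrier ell2 \<and> hdist ell2 x y < r"
    then have "y k \<in> ball (x k) r"
      using hdist_ell2_coord[OF x, of y k] by (simp add: dist_norm)
    then show "y k \<in> U" using r by blast
  qed (rule r)
qed simp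

lemma continuous_map_taylor_coord:
  "continuous_map (htopology ell2) euclidean (\<lambda>x. taylor_coord a (\<lambda>_. x) J m k)"
proof (induction J arbitrary: m k)
  case (Suc J)
  then show ?case
    using continuous_map_ell2_coord
    by (auto simp: continuous_map_atin intro!: tendsto_intros)
qed simp

lemma continuous_map_taylor_form:
  assumes a: "a \<in> carrier ell2"
  shows "continuous_map (htopology ell2) (htopology ell2) (\<lambda>x. taylor_form a m (\<lambda>_. x))"
proof (rule continuous_map_ell2I)
  show "(\<lambda>x. taylor_form a m (\<lambda>_. x)) \<in> topspace (htopology ell2) \<rightarrow> carrier ell2"
    using a by (auto intro: taylor_form_carrier)
  show "continuous_map (htopology ell2) euclidean (\<lambda>x. taylor_form a m (\<lambda>_. x) k)" for k
    unfolding taylor_form_def by (rule continuous_map_taylor_coord)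
  fix x0 and t :: real
  assume "x0 \<in> topspace (htopology ell2)" and t: "0 < t"
  then have x0: "x0 \<in> carrier ell2" by simp
  define r where "r = hnorm ell2 x0 + 1"
  define R where "R = 2 * (hnorm ell2 a)\<^sup>2 + 2 * r\<^sup>2"
  obtain N where N: "exp_tail R N < t"
    using order_tendstoD(2)[OF exp_tail_tendsto_0 t, of R]
    by (meson eventually_happens' sequentially_bot)
  have "(\<Sum>k\<in>{2^N..<n}. (cmod (taylor_form a m (\<lambda>_. x) k))\<^sup>2) \<le> t"
    if x: "x \<in> ell2.mball x0 1" for x n
  proof -
    have x_in: "x \<in> carrier ell2" and d: "hdist ell2 x x0 < 1"
      using x by (auto simp: ell2.commute)
    have "hnorm ell2 x \<le> r"
      using ell2.triangle[of x x0 "\<lambda>_. 0"] x_in x0 d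
      by (simp add: hdist_def ell2_diff carrier_ell2 r_def)
    then have "(\<Sum>k\<in>{2^N..<n}. (cmod (taylor_form a m (\<lambda>_. x) k))\<^sup>2) \<le> exp_tail R N"
      unfolding R_def using a x_in norm_taylor_form_le
      by (intro monom_map_dominated_tail[OF sum_power2_add_le]) auto
    then show ?thesis using N by simp
  qed
  then show "\<exists>U N. openin (htopology ell2) U \<and> x0 \<in> U \<and>
      (\<forall>x\<in>U. \<forall>n. (\<Sum>k\<in>{N..<n}. (cmod (taylor_form a m (\<lambda>_. x) k))\<^sup>2) \<le> t)"
    using x0 by (intro exI[of _ "ell2.mball x0 1"] exI[of _ "2^N"]) auto
qed

lemma polynomial_taylor_form:
  assumes "a \<in> carrier ell2"
  shows "continuous_homogeneous_polynomial ell2 ell2 m (\<lambda>x. taylor_form a m (\<lambda>_. x))"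
proof -
  have "taylor_form a m (\<lambda>_. x) = taylor_form a m (\<lambda>i\<in>{..<m}. x)" for x
    unfolding taylor_form_def by (intro ext taylor_coord_cong) simp
  then show ?thesis
    unfolding continuous_homogeneous_polynomial_def
    using continuous_map_taylor_form[OF assms] multilinear_taylor_form[OF assms] by blast
qed

lemma taylor_partial_sum_close:
  assumes a: "a \<in> carrier ell2" and h: "h \<in> carrier ell2" and r: "hnorm ell2 h \<le> r"
  shows "(hdist ell2 (\<lambda>k. \<Sum>m\<le>N. taylor_form a m (\<lambda>_. h) k) (monom_map (\<lambda>k. a k + h k)))\<^sup>2
    \<le> 4 * exp_tail (2 * (hnorm ell2 a)\<^sup>2 + 2 * r\<^sup>2) N"
proof -
  define g where "g = (\<lambda>j. cmod (a j) + cmod (h j))"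
  have R: "(\<Sum>k<n. (g k)\<^sup>2) \<le> 2 * (hnorm ell2 a)\<^sup>2 + 2 * r\<^sup>2" for n
    unfolding g_def using a h r by (rule sum_power2_add_le)
  have S: "cmod (\<Sum>m\<le>N. taylor_form a m (\<lambda>_. h) k) \<le> monom_map g k" for k
    using norm_taylor_form_diagonal_le[of a h k "Suc N"] by (simp add: g_def lessThan_Suc_atMost)
  have u: "cmod (monom_map (\<lambda>k. a k + h k) k) \<le> monom_map g k" for k
    unfolding norm_monom_map unfolding monom_map_def
    by (intro path_prod_mono) (auto simp: g_def norm_triangle_ineq)
  have head: "(\<Sum>m\<le>N. taylor_form a m (\<lambda>_. h) k) = monom_map (\<lambda>k. a k + h k) k" if "k < 2 ^ N" for k
  proof -
    have "floor_log k \<le> floor_log (2 ^ N)" using that by (intro floor_log_le_iff) simp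
    then show ?thesis
      using sum_taylor_coord[of "floor_log k" N a h k] by (simp add: taylor_form_def monom_map_def)
  qed
  have "(hdist ell2 (\<lambda>k. \<Sum>m\<le>N. taylor_form a m (\<lambda>_. h) k) (monom_map (\<lambda>k. a k + h k)))\<^sup>2
    \<le> real (2 ^ N) * 0\<^sup>2 + 4 * exp_tail (2 * (hnorm ell2 a)\<^sup>2 + 2 * r\<^sup>2) N"
    by (rule hdist_ell2_le_head_tail)
      (use head monom_map_dominated_carrier[OF R S] monom_map_dominated_carrier[OF R u]
        monom_map_dominated_tail[OF R S] monom_map_dominated_tail[OF R u] in auto)
  then show ?thesis by simp
qed

lemma holomorphic_monom_map:
  assumes U: "openin (htopology ell2) U"
  shows "holomorphic_between ell2 ell2 U monom_map"
  unfolding holomorphic_between_def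
proof (intro conjI ballI U)
  have U_sub: "U \<subseteq> carrier ell2" using U by (simp add: ell2.openin_mtopology)
  then show "monom_map \<in> U \<rightarrow> carrier ell2" using monom_map_carrier by auto
  fix a assume "a \<in> U"
  then have a: "a \<in> carrier ell2" using U_sub by auto
  obtain r where r: "0 < r" "ell2.mball a r \<subseteq> U"
    using U \<open>a \<in> U\<close> by (auto simp: ell2.openin_mtopology)
  define R where "R = 2 * (hnorm ell2 a)\<^sup>2 + 2 * r\<^sup>2"
  let ?S = "\<lambda>N x. monom_map a \<oplus>\<^bsub>ell2\<^esub> (\<Oplus>\<^bsub>ell2\<^esub>m\<in>{1..N}. taylor_form a m (\<lambda>_. x \<ominus>\<^bsub>ell2\<^esub> a))"
  have close: "(hdist ell2 (?S N x) (monom_map x))\<^sup>2 \<le> 4 * exp_tail R N"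
    if "x \<in> ell2.mball a r" for x N
  proof -
    have x: "x \<in> carrier ell2" and d: "hdist ell2 x a < r"
      using that by (auto simp: ell2.commute)
    define h where "h = (\<lambda>k. x k - a k)"
    have h: "h \<in> carrier ell2" using carrier_ell2_diff[OF x a] by (simp add: h_def)
    have "hnorm ell2 h \<le> r" using d x a by (simp add: hdist_def ell2_diff h_def)
    note taylor_partial_sum_close[OF a h this, of N]
    moreover have "(\<lambda>k. a k + h k) = x" by (simp add: h_def)
    moreover have "?S N x = (\<lambda>k. \<Sum>m\<le>N. taylor_form a m (\<lambda>_. h) k)"
    proof -
      have "{..N} = insert 0 {1..N}" by auto
      moreover have "x \<ominus>\<^bsub>ell2\<^esub> a = h" using ell2_diff[OF x a] by (simp add: h_def)
      moreover have "taylor_form a 0 v = monom_map a" for v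
        by (simp add: taylor_form_def monom_map_def taylor_coord_0 fun_eq_iff)
      ultimately show ?thesis
        using taylor_form_carrier[OF a, of _ "\<lambda>_. h"] h by (simp add: finsum_ell2)
    qed
    ultimately show ?thesis by (simp add: R_def)
  qed
  have "uniform_limit (ell2.mball a r) (\<lambda>N x. hdist ell2 (?S N x) (monom_map x)) (\<lambda>x. 0) sequentially"
  proof (rule uniform_limitI)
    fix e :: real assume e: "0 < e"
    have "(\<lambda>N. 4 * exp_tail R N) \<longlonglongrightarrow> 4 * 0"
      by (intro tendsto_intros exp_tail_tendsto_0)
    then have "\<forall>\<^sub>F N in sequentially. 4 * exp_tail R N < e\<^sup>2"
      using order_tendstoD(2)[of _ "4 * 0" sequentially "e\<^sup>2"] e by simp
    then show "\<forall>\<^sub>F N in sequentially. \<forall>x\<in>ell2.mball a r.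
        dist (hdist ell2 (?S N x) (monom_map x)) 0 < e"
    proof eventually_elim
      case (elim N)
      show ?case
      proof
        fix x assume "x \<in> ell2.mball a r"
        from le_less_trans[OF close[OF this] elim]
        have "hdist ell2 (?S N x) (monom_map x) < e"
          using e by (simp add: power2_less_imp_less)
        then show "dist (hdist ell2 (?S N x) (monom_map x)) 0 < e" by simp
      qed
    qed
  qed
  then show "\<exists>r>0. \<exists>P. ell2.mball a r \<subseteq> U \<and>
      (\<forall>m\<ge>1. continuous_homogeneous_polynomial ell2 ell2 m (P m)) \<and>
      uniform_limit (ell2.mball a r)
        (\<lambda>N x. hdist ell2 (monom_map a \<oplus>\<^bsub>ell2\<^esub> (\<Oplus>\<^bsub>ell2\<^esub>m\<in>{1..N}. P m (x \<ominus>\<^bsub>ell2\<^esub> a))) (monom_map x))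
        (\<lambda>x. 0) sequentially"
    using r polynomial_taylor_form[OF a]
    by (intro exI[of _ r] conjI exI[of _ "\<lambda>m x. taylor_form a m (\<lambda>_. x)"] allI impI)
qed

section \<open>Kolmogorov widths of sets of sequences\<close>

lemma homogeneous_system_nontrivial:
  fixes f :: "'b \<Rightarrow> 'a \<Rightarrow> 'c::field"
  assumes "finite B" "finite T" "card B < card T"
  shows "\<exists>y. (\<exists>t. y t \<noteq> 0) \<and> (\<forall>t. t \<notin> T \<longrightarrow> y t = 0) \<and> (\<forall>b\<in>B. (\<Sum>t\<in>T. f b t * y t) = 0)"
  using assms
proof (induction B arbitrary: T f rule: finite_induct)
  case empty
  then obtain t where "t \<in> T" by (metis card.empty card_gt_0_iff ex_in_conv)
  then show ?case by (intro exI[of _ "\<lambda>s. if s = t then 1 else 0"]) auto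
next
  case (insert b B)
  show ?case
  proof (cases "\<forall>t\<in>T. f b t = 0")
    case True
    have "card B < card T" using insert by simp
    from insert.IH[OF \<open>finite T\<close> this, of f] show ?thesis using True by auto
  next
    case False
    then obtain t0 where t0: "t0 \<in> T" "f b t0 \<noteq> 0" by blast
    define f' where "f' c t = f c t - f c t0 * f b t / f b t0" for c t
    have "card B < card (T - {t0})" using insert t0 by simp
    from insert.IH[OF _ this, of f'] insert.prems
    obtain y where y: "\<exists>t. y t \<noteq> 0" "\<And>t. t \<notin> T - {t0} \<Longrightarrow> y t = 0"
      "\<And>c. c \<in> B \<Longrightarrow> (\<Sum>t\<in>T - {t0}. f' c t * y t) = 0" by blast
    define q where "q = - (\<Sum>t\<in>T - {t0}. f b t * y t) / f b t0"
    define z where "z = y(t0 := q)"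
    have sum_z: "(\<Sum>t\<in>T. f c t * z t) = f c t0 * q + (\<Sum>t\<in>T - {t0}. f c t * y t)" for c
    proof -
      have "(\<Sum>t\<in>T. f c t * z t) = f c t0 * z t0 + (\<Sum>t\<in>T - {t0}. f c t * z t)"
        using insert.prems t0 by (simp add: sum.remove)
      then show ?thesis by (simp add: z_def)
    qed
    have "(\<Sum>t\<in>T. f c t * z t) = 0" if c: "c \<in> B" for c
    proof -
      have "0 = (\<Sum>t\<in>T - {t0}. f c t * y t - f c t0 / f b t0 * (f b t * y t))"
        using y(3)[OF c] by (simp add: f'_def left_diff_distrib mult.assoc)
      also have "\<dots> = (\<Sum>t\<in>T. f c t * z t)"
        unfolding sum_z sum_subtractf sum_distrib_left[symmetric] by (simp add: q_def)
      finally show ?thesis by simp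
    qed
    moreover have "(\<Sum>t\<in>T. f b t * z t) = 0"
      unfolding sum_z using t0 by (simp add: q_def)
    moreover have "\<exists>t. z t \<noteq> 0"
      using y(1) y(2)[of t0] by (auto simp: z_def)
    ultimately show ?thesis
      using y(2) t0 by (intro exI[of _ z]) (auto simp: z_def)
  qed
qed

lemma inprod_ell2_finite_support:
  assumes "finite T" "\<And>k. k \<notin> T \<Longrightarrow> y k = 0"
  shows "inprod ell2 x y = (\<Sum>k\<in>T. x k * cnj (y k))"
  unfolding inprod_ell2 using assms by (intro suminf_finite) auto

lemma hnorm_ell2_finite_support:
  assumes "finite T" "\<And>k. k \<notin> T \<Longrightarrow> y k = 0"
  shows "hnorm ell2 y = sqrt (\<Sum>k\<in>T. (cmod (y k))\<^sup>2)"
proof -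
  have "(\<Sum>k. (cmod (y k))\<^sup>2) = (\<Sum>k\<in>T. (cmod (y k))\<^sup>2)"
    using assms by (intro suminf_finite) auto
  then show ?thesis
    using hnorm_ell2[OF carrier_ell2_finite_support[OF assms]] by simp
qed

lemma cmod_inprod_ell2_le:
  assumes x: "x \<in> carrier ell2" and y: "y \<in> carrier ell2"
  shows "cmod (inprod ell2 x y) \<le> hnorm ell2 x * hnorm ell2 y"
proof (cases "inprod ell2 x y = 0")
  case True
  then show ?thesis using x y ell2.hnorm_nonneg by simp
next
  case False
  define c where "c = cnj (sgn (inprod ell2 x y))"
  have c: "cmod c = 1" using False by (simp add: c_def norm_sgn)
  have "hnorm ell2 (\<lambda>k. c * x k) = hnorm ell2 x"
    using x c by (simp add: hnorm_ell2 carrier_ell2_smult norm_mult)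
  moreover have "inprod ell2 (\<lambda>k. c * x k) y = of_real (cmod (inprod ell2 x y))"
  proof -
    have "inprod ell2 (\<lambda>k. c * x k) y = c * inprod ell2 x y"
      using ell2.inprod_smult_left[OF x y, of c] by simp
    also have "\<dots> = of_real (cmod (inprod ell2 x y))"
      using False complex_norm_square[of "inprod ell2 x y"]
      by (simp add: c_def sgn_eq power2_eq_square field_simps)
    finally show ?thesis .
  qed
  ultimately show ?thesis
    using ell2.Re_inprod_le[OF carrier_ell2_smult[OF x, of c] y] by simp
qed

lemma coordinate_subspace_dim_le:
  "{x \<in> carrier ell2. \<forall>k\<ge>n. x k = 0} \<in> subspaces_dim_le ell2 n"
proof -
  let ?V = "{x \<in> carrier ell2. \<forall>k\<ge>n. x k = 0}"
  define e where "e = (\<lambda>(i::nat) k. if k = i then 1 else 0 :: complex)"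
  have inj: "inj_on e A" for A by (auto simp: inj_on_def e_def fun_eq_iff)
  have e_in: "e i \<in> carrier ell2" for i
    by (rule carrier_ell2_finite_support[of "{i}"]) (auto simp: e_def)
  have comb: "(\<Oplus>\<^bsub>ell2\<^esub>b\<in>e ` {..<n}. c b \<odot>\<^bsub>ell2\<^esub> b) = (\<lambda>k. if k < n then c (e k) else 0)" for c
  proof -
    have "(\<Oplus>\<^bsub>ell2\<^esub>b\<in>e ` {..<n}. c b \<odot>\<^bsub>ell2\<^esub> b) = (\<lambda>k. \<Sum>b\<in>e ` {..<n}. c b * b k)"
      using e_in carrier_ell2_smult by (subst finsum_ell2) auto
    also have "\<dots> = (\<lambda>k. \<Sum>i<n. c (e i) * e i k)"
      by (subst sum.reindex[OF inj]) simp
    also have "\<dots> = (\<lambda>k. if k < n then c (e k) else 0)"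
      by (auto simp: e_def fun_eq_iff if_distrib sum.delta cong: if_cong)
    finally show ?thesis .
  qed
  have "submodule ?V complex_ring ell2"
    by (rule ell2.submoduleI)
      (use carrier_ell2_add carrier_ell2_smult carrier_ell2_uminus in
        \<open>auto simp: ell2_minus carrier_ell2\<close>)
  moreover have "is_basis ell2 ?V (e ` {..<n})"
    unfolding is_basis_def comb
  proof (intro conjI allI impI ballI)
    show "e ` {..<n} \<subseteq> ?V" using e_in by (auto simp: e_def)
    show "c b = 0" if "(\<lambda>k. if k < n then c (e k) else 0) = \<zero>\<^bsub>ell2\<^esub>" "b \<in> e ` {..<n}" for c b
      using that by (auto simp: fun_eq_iff split: if_splits)
    show "\<exists>c. v = (\<lambda>k. if k < n then c (e k) else 0)" if "v \<in> ?V" for v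
      using that by (intro exI[of _ "\<lambda>b. v (the_inv_into UNIV e b)"])
        (auto simp: fun_eq_iff the_inv_into_f_f[OF inj])
  qed simp
  ultimately show ?thesis
    using card_image_le[of "{..<n}" e] unfolding subspaces_dim_le_def by auto
qed

lemma kolmogorov_width_ell2_le:
  assumes A: "A \<subseteq> carrier ell2" and c: "0 \<le> c"
    and tail: "\<And>a N. a \<in> A \<Longrightarrow> (\<Sum>k\<in>{n..<N}. (cmod (a k))\<^sup>2) \<le> c\<^sup>2"
  shows "kolmogorov_width ell2 n A \<le> ennreal c"
  unfolding kolmogorov_width_def
proof (intro INF_lower2[OF coordinate_subspace_dim_le] SUP_least)
  fix a assume a: "a \<in> A"
  define v where "v = (\<lambda>k. if k < n then a k else 0)"
  have v: "v \<in> carrier ell2"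
    by (rule carrier_ell2_finite_support[of "{..<n}"]) (auto simp: v_def)
  have "(\<Sum>k<N. (cmod (a k - v k))\<^sup>2) \<le> c\<^sup>2" for N
  proof -
    have "(\<Sum>k<N. (cmod (a k - v k))\<^sup>2) = (\<Sum>k\<in>{n..<N}. (cmod (a k - v k))\<^sup>2)"
      by (rule sum.mono_neutral_right) (auto simp: v_def)
    also have "\<dots> = (\<Sum>k\<in>{n..<N}. (cmod (a k))\<^sup>2)"
      by (rule sum.cong) (auto simp: v_def)
    finally show ?thesis using tail[OF a, of N] by simp
  qed
  from hnorm_ell2_le(2)[OF c this] have "hnorm ell2 (a \<ominus>\<^bsub>ell2\<^esub> v) \<le> c"
    using A a v by (subst ell2_diff) auto
  then show "(INF v\<in>{x \<in> carrier ell2. \<forall>k\<ge>n. x k = 0}. ennreal (hnorm ell2 (a \<ominus>\<^bsub>ell2\<^esub> v))) \<le> ennreal c"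
    using v by (intro INF_lower2[of v] ennreal_leI) (auto simp: v_def)
qed

text \<open>The vector \<open>y\<close> in the hypothesis gets chosen orthogonal to the approximating subspace.\<close>

lemma kolmogorov_width_ell2_ge:
  assumes A: "A \<subseteq> carrier ell2" and T: "finite T" "n < card T"
    and test: "\<And>y. \<exists>a\<in>A. d * sqrt (\<Sum>t\<in>T. (cmod (y t))\<^sup>2) \<le> cmod (\<Sum>t\<in>T. a t * cnj (y t))"
  shows "ennreal d \<le> kolmogorov_width ell2 n A"
  unfolding kolmogorov_width_def
proof (rule INF_greatest)
  fix V assume "V \<in> subspaces_dim_le ell2 n"
  then obtain B where sub: "submodule V complex_ring ell2" and B: "is_basis ell2 V B" "card B \<le> n"
    by (auto simp: subspaces_dim_le_def)
  have V: "V \<subseteq> carrier ell2" using ell2.submoduleE(1)[OF sub] .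
  have finB: "finite B" and B_sub: "B \<subseteq> carrier ell2" using B V by (auto simp: is_basis_def)
  obtain z where z: "\<exists>t. z t \<noteq> 0" "\<And>t. t \<notin> T \<Longrightarrow> z t = 0"
    and orth: "\<And>b. b \<in> B \<Longrightarrow> (\<Sum>t\<in>T. b t * z t) = 0"
    using homogeneous_system_nontrivial[OF finB T(1) le_less_trans[OF B(2) T(2)], of "\<lambda>b. b"]
    by blast
  define y where "y = (\<lambda>t. cnj (z t))"
  have y_supp: "\<And>t. t \<notin> T \<Longrightarrow> y t = 0" using z by (simp add: y_def)
  have inprod_y: "inprod ell2 x y = (\<Sum>k\<in>T. x k * cnj (y k))" for x
    using T(1) y_supp by (rule inprod_ell2_finite_support)
  have hnorm_y: "hnorm ell2 y = sqrt (\<Sum>k\<in>T. (cmod (y k))\<^sup>2)"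
    using T(1) y_supp by (rule hnorm_ell2_finite_support)
  have y: "y \<in> carrier ell2" using carrier_ell2_finite_support[OF T(1) y_supp] .
  have y_pos: "0 < hnorm ell2 y"
    using ell2.hnorm_eq_0[OF y] ell2.hnorm_nonneg[OF y] z(1) by (auto simp: y_def fun_eq_iff)
  have orthV: "inprod ell2 v y = 0" if "v \<in> V" for v
  proof -
    from B(1) have "\<forall>v\<in>V. \<exists>c. v = (\<Oplus>\<^bsub>ell2\<^esub>b\<in>B. c b \<odot>\<^bsub>ell2\<^esub> b)"
      unfolding is_basis_def by (elim conjE)
    from bspec[OF this that] obtain c where c: "v = (\<Oplus>\<^bsub>ell2\<^esub>b\<in>B. c b \<odot>\<^bsub>ell2\<^esub> b)"
      by (rule exE)
    have "v = (\<lambda>k. \<Sum>b\<in>B. c b * b k)"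
      unfolding c using finB B_sub carrier_ell2_smult by (subst finsum_ell2) auto
    then have "inprod ell2 v y = (\<Sum>t\<in>T. \<Sum>b\<in>B. c b * (b t * z t))"
      unfolding inprod_y
      by (simp add: y_def sum_distrib_right mult.assoc)
    also have "\<dots> = (\<Sum>b\<in>B. c b * (\<Sum>t\<in>T. b t * z t))"
      by (subst sum.swap) (simp add: sum_distrib_left)
    finally show ?thesis using orth by simp
  qed
  obtain a where a: "a \<in> A" "d * sqrt (\<Sum>t\<in>T. (cmod (y t))\<^sup>2) \<le> cmod (\<Sum>t\<in>T. a t * cnj (y t))"
    using test[of y] by blast
  then have a_in: "a \<in> carrier ell2" using A by auto
  have "d \<le> hnorm ell2 (a \<ominus>\<^bsub>ell2\<^esub> v)" if v: "v \<in> V" for v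
  proof -
    have v_in: "v \<in> carrier ell2" using v V by auto
    have "d * hnorm ell2 y \<le> cmod (inprod ell2 a y)"
      using a(2) by (simp add: inprod_y hnorm_y)
    also have "inprod ell2 a y = inprod ell2 (a \<ominus>\<^bsub>ell2\<^esub> v) y"
      using orthV[OF v] ell2.inprod_add_left[OF a_in, of "\<ominus>\<^bsub>ell2\<^esub> v" y]
        ell2.inprod_minus_left[OF v_in y] v_in y by (simp add: a_minus_def del: ell2_simps)
    also have "cmod \<dots> \<le> hnorm ell2 (a \<ominus>\<^bsub>ell2\<^esub> v) * hnorm ell2 y"
      using a_in v_in y by (intro cmod_inprod_ell2_le) (auto simp del: ell2_simps)
    finally show ?thesis using y_pos by simp
  qed
  then have "ennreal d \<le> (INF v\<in>V. ennreal (hnorm ell2 (a \<ominus>\<^bsub>ell2\<^esub> v)))"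
    by (intro INF_greatest ennreal_leI) auto
  then show "ennreal d \<le> (SUP a\<in>A. INF v\<in>V. ennreal (hnorm ell2 (a \<ominus>\<^bsub>ell2\<^esub> v)))"
    using a(1) by (rule order_trans[OF _ SUP_upper])
qed

lemma box_lower_width:
  fixes s :: "nat \<Rightarrow> real"
  assumes s: "summable (\<lambda>k. (s k)\<^sup>2)" "\<And>k. 0 \<le> s k" and d: "\<And>k. k \<le> n \<Longrightarrow> d \<le> s k" "0 \<le> d"
  shows "ennreal d \<le> kolmogorov_width ell2 n {x. \<forall>k. cmod (x k) \<le> s k}"
proof (rule kolmogorov_width_ell2_ge)
  show "{x. \<forall>k. cmod (x k) \<le> s k} \<subseteq> carrier ell2"
    using carrier_ell2_dominated[OF s(1)] by auto
  fix y :: "nat \<Rightarrow> complex"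
  define a where "a = (\<lambda>k. of_real (s k) * sgn (y k))"
  have "a \<in> {x. \<forall>k. cmod (x k) \<le> s k}"
    using s(2) by (auto simp: a_def norm_mult norm_sgn)
  moreover have "d * sqrt (\<Sum>t\<le>n. (cmod (y t))\<^sup>2) \<le> cmod (\<Sum>t\<le>n. a t * cnj (y t))"
  proof -
    have "a t * cnj (y t) = of_real (s t * cmod (y t))" for t
      using complex_norm_square[of "y t"]
      by (cases "y t = 0") (auto simp: a_def sgn_eq power2_eq_square field_simps)
    then have "cmod (\<Sum>t\<le>n. a t * cnj (y t)) = (\<Sum>t\<le>n. s t * cmod (y t))"
      using s(2) by (simp add: sum_nonneg flip: of_real_sum of_real_mult)
    moreover have "sqrt (\<Sum>t\<le>n. (cmod (y t))\<^sup>2) \<le> (\<Sum>t\<le>n. cmod (y t))"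
      using L2_set_le_sum[of "{..n}" "\<lambda>t. cmod (y t)"] by (simp add: L2_set_def)
    then have "d * sqrt (\<Sum>t\<le>n. (cmod (y t))\<^sup>2) \<le> d * (\<Sum>t\<le>n. cmod (y t))"
      using d(2) by (rule mult_left_mono)
    moreover have "d * (\<Sum>t\<le>n. cmod (y t)) \<le> (\<Sum>t\<le>n. s t * cmod (y t))"
      unfolding sum_distrib_left using d by (intro sum_mono mult_right_mono) auto
    ultimately show ?thesis by linarith
  qed
  ultimately show "\<exists>a\<in>{x. \<forall>k. cmod (x k) \<le> s k}.
      d * sqrt (\<Sum>t\<le>n. (cmod (y t))\<^sup>2) \<le> cmod (\<Sum>t\<le>n. a t * cnj (y t))" by blast
qed simp_all

lemma kolmogorov_width_ell2_le_exp:
  fixes w :: "nat \<Rightarrow> real"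
  assumes A: "A \<subseteq> carrier ell2" and w: "mono w" and S: "summable (\<lambda>k. exp (- w k))"
    and bound: "\<And>a k. a \<in> A \<Longrightarrow> cmod (a k) \<le> exp (- w k)"
  shows "kolmogorov_width ell2 n A \<le> ennreal (sqrt (\<Sum>k. exp (- w k)) * exp (- w n / 2))"
proof (rule kolmogorov_width_ell2_le[OF A])
  have S_nonneg: "0 \<le> (\<Sum>k. exp (- w k))" by (intro suminf_nonneg S) auto
  then show "0 \<le> sqrt (\<Sum>k. exp (- w k)) * exp (- w n / 2)" by simp
  fix a N assume a: "a \<in> A"
  have "(\<Sum>k\<in>{n..<N}. (cmod (a k))\<^sup>2) \<le> (\<Sum>k\<in>{n..<N}. exp (- w n) * exp (- w k))"
  proof (rule sum_mono)
    fix k assume "k \<in> {n..<N}"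
    then have "w n \<le> w k" using w by (auto intro: monoD)
    have "(cmod (a k))\<^sup>2 \<le> (exp (- w k))\<^sup>2"
      using bound[OF a] by (intro power_mono) auto
    also have "\<dots> \<le> exp (- w n) * exp (- w k)"
      using \<open>w n \<le> w k\<close> by (simp add: power2_eq_square flip: exp_add)
    finally show "(cmod (a k))\<^sup>2 \<le> exp (- w n) * exp (- w k)" .
  qed
  also have "\<dots> \<le> exp (- w n) * (\<Sum>k. exp (- w k))"
    unfolding sum_distrib_left[symmetric] by (intro mult_left_mono sum_le_suminf S) auto
  also have "\<dots> = (sqrt (\<Sum>k. exp (- w k)) * exp (- w n / 2))\<^sup>2"
    using S_nonneg by (simp add: power_mult_distrib mult.commute flip: exp_double)
  finally show "(\<Sum>k\<in>{n..<N}. (cmod (a k))\<^sup>2) \<le> (sqrt (\<Sum>k. exp (- w k)) * exp (- w n / 2))\<^sup>2" .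
qed

section \<open>Widths of the image of a box\<close>

lemma path_prod_cong:
  "(\<And>j. j < 2 * J \<Longrightarrow> x j = x' j) \<Longrightarrow> path_prod x J k = path_prod x' J k"
proof (induction J arbitrary: k)
  case (Suc J)
  have "2 * J + k mod 2 < 2 * Suc J" by simp
  then show ?case using Suc by simp
qed simp

text \<open>The signs are chosen greedily from the last pair of variables to the first: by the parallelogram
  law one of the two signs loses at most the factor \<open>\<tau> J\<^sup>2\<close> in the sum of squares.\<close>

lemma exists_large_block_functional:
  fixes y :: "nat \<Rightarrow> complex" and \<tau> :: "nat \<Rightarrow> real"
  assumes \<tau>: "\<And>j. 0 \<le> \<tau> j"
  shows "\<exists>x. (\<forall>k. cmod (x k) \<le> \<tau> (k div 2)) \<and>
    (\<Prod>j<J. \<tau> j)\<^sup>2 * (\<Sum>k\<in>{2^J..<2^Suc J}. (cmod (y k))\<^sup>2)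
      \<le> (cmod (\<Sum>k\<in>{2^J..<2^Suc J}. path_prod x J k * y k))\<^sup>2"
proof (induction J arbitrary: y)
  case 0
  have "{1..<2::nat} = {1}" by auto
  then show ?case using \<tau> by (intro exI[of _ "\<lambda>_. 0"]) simp
next
  case (Suc J)
  let ?I = "{2^J..<2^Suc J} :: nat set"
  define w where "w \<sigma> k = of_real (\<tau> J) * (y (2*k) + \<sigma> * y (2*k+1))" for \<sigma> k
  define Q where "Q \<sigma> = (\<Sum>k\<in>?I. (cmod (w \<sigma> k))\<^sup>2)" for \<sigma>
  have parallelogram: "(cmod (a + b))\<^sup>2 + (cmod (a - b))\<^sup>2 = 2 * ((cmod a)\<^sup>2 + (cmod b)\<^sup>2)" for a b
    unfolding cmod_power2 by (simp add: power2_eq_square algebra_simps)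
  have double: "(\<Sum>k\<in>{2^Suc J..<2^Suc (Suc J)}. F k) = (\<Sum>k\<in>?I. F (2*k) + F (2*k+1))"
    for F :: "nat \<Rightarrow> 'z::comm_monoid_add"
    using sum_double_interval[of F "2^J" "2^Suc J"] by simp
  have cmod_w: "(cmod (w \<sigma> k))\<^sup>2 = (\<tau> J)\<^sup>2 * (cmod (y (2*k) + \<sigma> * y (2*k+1)))\<^sup>2" for \<sigma> k
    by (simp add: w_def norm_mult power_mult_distrib)
  have w_sum: "(cmod (w 1 k))\<^sup>2 + (cmod (w (-1) k))\<^sup>2
    = (\<tau> J)\<^sup>2 * (2 * ((cmod (y (2*k)))\<^sup>2 + (cmod (y (2*k+1)))\<^sup>2))" for k
    unfolding parallelogram[symmetric] by (simp add: cmod_w distrib_left)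
  have "Q 1 + Q (-1) = (\<Sum>k\<in>?I. (\<tau> J)\<^sup>2 * (2 * ((cmod (y (2*k)))\<^sup>2 + (cmod (y (2*k+1)))\<^sup>2)))"
    unfolding Q_def sum.distrib[symmetric] by (simp only: w_sum)
  also have "\<dots> = 2 * ((\<tau> J)\<^sup>2 * (\<Sum>k\<in>{2^Suc J..<2^Suc (Suc J)}. (cmod (y k))\<^sup>2))"
    unfolding double sum_distrib_left by (intro sum.cong refl) (simp add: algebra_simps)
  finally have "\<exists>\<sigma>\<in>{1,-1}. (\<tau> J)\<^sup>2 * (\<Sum>k\<in>{2^Suc J..<2^Suc (Suc J)}. (cmod (y k))\<^sup>2) \<le> Q \<sigma>"
    by (cases "Q 1 \<le> Q (-1)") auto
  then obtain \<sigma> where \<sigma>: "\<sigma> \<in> {1,-1}"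
    "(\<tau> J)\<^sup>2 * (\<Sum>k\<in>{2^Suc J..<2^Suc (Suc J)}. (cmod (y k))\<^sup>2) \<le> Q \<sigma>" by blast
  obtain x where x: "\<And>k. cmod (x k) \<le> \<tau> (k div 2)"
    "(\<Prod>j<J. \<tau> j)\<^sup>2 * Q \<sigma> \<le> (cmod (\<Sum>k\<in>?I. path_prod x J k * w \<sigma> k))\<^sup>2"
    using Suc[of "w \<sigma>"] unfolding Q_def by blast
  define x' where "x' = x(2*J := of_real (\<tau> J), 2*J+1 := of_real (\<tau> J) * \<sigma>)"
  have "cmod (x' k) \<le> \<tau> (k div 2)" for k
    using x(1)[of k] \<sigma>(1) \<tau>[of J] by (auto simp: x'_def norm_mult)
  moreover have "(\<Prod>j<Suc J. \<tau> j)\<^sup>2 * (\<Sum>k\<in>{2^Suc J..<2^Suc (Suc J)}. (cmod (y k))\<^sup>2)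
      \<le> (cmod (\<Sum>k\<in>{2^Suc J..<2^Suc (Suc J)}. path_prod x' (Suc J) k * y k))\<^sup>2"
  proof -
    have "path_prod x' J k = path_prod x J k" for k
      by (rule path_prod_cong) (simp add: x'_def)
    then have "path_prod x' (Suc J) (2*k) = path_prod x J k * of_real (\<tau> J)"
      "path_prod x' (Suc J) (2*k+1) = path_prod x J k * (of_real (\<tau> J) * \<sigma>)" for k
      by (simp_all add: x'_def)
    then have "(\<Sum>k\<in>{2^Suc J..<2^Suc (Suc J)}. path_prod x' (Suc J) k * y k)
      = (\<Sum>k\<in>?I. path_prod x J k * w \<sigma> k)"
      unfolding double w_def by (simp only: ring_distribs mult_ac)
    moreover have "(\<Prod>j<Suc J. \<tau> j)\<^sup>2 * (\<Sum>k\<in>{2^Suc J..<2^Suc (Suc J)}. (cmod (y k))\<^sup>2)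
      \<le> (\<Prod>j<J. \<tau> j)\<^sup>2 * Q \<sigma>"
      using mult_left_mono[OF \<sigma>(2), of "(\<Prod>j<J. \<tau> j)\<^sup>2"] by (simp add: power_mult_distrib mult.assoc)
    ultimately show ?thesis using x(2) by simp
  qed
  ultimately show ?case by blast
qed

lemma path_prod_paired: "path_prod (\<lambda>k. \<tau> (k div 2)) J k = (\<Prod>j<J. \<tau> j)"
  by (induction J arbitrary: k) auto

lemma path_prod_dominated:
  assumes "\<And>k. cmod (x k) \<le> \<tau> (k div 2)"
  shows "cmod (path_prod x J k) \<le> (\<Prod>j<J. \<tau> j)"
proof -
  have "cmod (path_prod x J k) \<le> path_prod (\<lambda>k. \<tau> (k div 2)) J k"
    unfolding norm_path_prod by (rule path_prod_mono) (use assms in auto)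
  then show ?thesis by (simp add: path_prod_paired)
qed

lemma monom_map_box_lower_width:
  fixes \<tau> :: "nat \<Rightarrow> real"
  assumes K: "K = {x. \<forall>k. cmod (x k) \<le> \<tau> (k div 2)}" "K \<subseteq> carrier ell2"
    and \<tau>: "\<And>j. 0 \<le> \<tau> j" and n: "n < 2 ^ J"
  shows "ennreal (\<Prod>j<J. \<tau> j) \<le> kolmogorov_width ell2 n (monom_map ` K)"
proof (rule kolmogorov_width_ell2_ge)
  let ?T = "{2^J..<2^Suc J} :: nat set"
  show "monom_map ` K \<subseteq> carrier ell2" using K monom_map_carrier by auto
  show "finite ?T" "n < card ?T" using n by auto
  fix y :: "nat \<Rightarrow> complex"
  obtain x where x: "\<And>k. cmod (x k) \<le> \<tau> (k div 2)"
    "(\<Prod>j<J. \<tau> j)\<^sup>2 * (\<Sum>k\<in>?T. (cmod (cnj (y k)))\<^sup>2) \<le> (cmod (\<Sum>k\<in>?T. path_prod x J k * cnj (y k)))\<^sup>2"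
    using exists_large_block_functional[of \<tau> J "\<lambda>k. cnj (y k)"] \<tau> by blast
  have "(\<Prod>j<J. \<tau> j) * sqrt (\<Sum>k\<in>?T. (cmod (y k))\<^sup>2)
    = sqrt ((\<Prod>j<J. \<tau> j)\<^sup>2 * (\<Sum>k\<in>?T. (cmod (cnj (y k)))\<^sup>2))"
    using \<tau> by (simp add: real_sqrt_mult prod_nonneg)
  also have "\<dots> \<le> cmod (\<Sum>k\<in>?T. path_prod x J k * cnj (y k))"
    using x(2) by (intro real_le_lsqrt) auto
  also have "(\<Sum>k\<in>?T. path_prod x J k * cnj (y k)) = (\<Sum>k\<in>?T. monom_map x k * cnj (y k))"
    by (intro sum.cong refl) (simp only: monom_map_block)
  finally have "(\<Prod>j<J. \<tau> j) * sqrt (\<Sum>k\<in>?T. (cmod (y k))\<^sup>2)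
    \<le> cmod (\<Sum>k\<in>?T. monom_map x k * cnj (y k))" .
  moreover have "x \<in> K" using x(1) K by simp
  ultimately show "\<exists>a\<in>monom_map ` K. (\<Prod>j<J. \<tau> j) * sqrt (\<Sum>k\<in>?T. (cmod (y k))\<^sup>2)
    \<le> cmod (\<Sum>k\<in>?T. a k * cnj (y k))" by blast
qed

section \<open>Asymptotic estimates\<close>

definition powr_sum :: "real \<Rightarrow> nat \<Rightarrow> real"
  where "powr_sum \<alpha> J = (\<Sum>j<J. (real j + 1) powr \<alpha>)"

lemma mono_powr_sum: "mono (powr_sum \<alpha>)"
  unfolding powr_sum_def by (intro monoI sum_mono2) auto

lemma powr_sum_upper:
  assumes "0 < \<alpha>"
  shows "powr_sum \<alpha> J \<le> real J powr (\<alpha> + 1)"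
proof -
  have "powr_sum \<alpha> J \<le> (\<Sum>j<J. real J powr \<alpha>)"
    unfolding powr_sum_def using assms by (intro sum_mono powr_mono2) auto
  also have "\<dots> = real J powr (\<alpha> + 1)"
    using powr_mult_base[of "real J" \<alpha>] by (simp add: add.commute)
  finally show ?thesis .
qed

lemma powr_sum_lower:
  assumes "0 < \<alpha>"
  shows "(real J / 2) powr (\<alpha> + 1) \<le> powr_sum \<alpha> J"
proof -
  have "(real J / 2) powr (\<alpha> + 1) = real J / 2 * (real J / 2) powr \<alpha>"
    using powr_mult_base[of "real J / 2" \<alpha>] by (simp add: add.commute)
  also have "\<dots> \<le> real (J - J div 2) * (real J / 2) powr \<alpha>"
    by (intro mult_right_mono powr_ge_zero) linarith
  also have "\<dots> = (\<Sum>j\<in>{J div 2..<J}. (real J / 2) powr \<alpha>)" by simp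
  also have "\<dots> \<le> (\<Sum>j\<in>{J div 2..<J}. (real j + 1) powr \<alpha>)"
  proof (intro sum_mono powr_mono2)
    fix j assume "j \<in> {J div 2..<J}"
    then show "real J / 2 \<le> real j + 1" by simp linarith
  qed (use assms in auto)
  also have "\<dots> \<le> powr_sum \<alpha> J"
    unfolding powr_sum_def by (intro sum_mono2) auto
  finally show ?thesis .
qed

lemma summable_exp_neg_powr:
  assumes "0 < \<alpha>"
  shows "summable (\<lambda>k. exp (- ((real (k div 2) + 1) powr \<alpha>)))"
proof (rule summable_comparison_test_bigo)
  show "summable (\<lambda>k. norm (1 / real k ^ 2))"
    using inverse_power_summable[of 2, where ?'a = real] by (simp add: field_simps)
  have "(\<lambda>k. exp (- ((real (k div 2) + 1) powr \<alpha>))) \<in> O(\<lambda>k. exp (- ((real k / 2) powr \<alpha>)))"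
  proof (rule bigoI[where c = 1], rule always_eventually, rule allI)
    fix k :: nat
    have "(real k / 2) powr \<alpha> \<le> (real (k div 2) + 1) powr \<alpha>"
      using assms by (intro powr_mono2) linarith+
    then show "norm (exp (- ((real (k div 2) + 1) powr \<alpha>))) \<le> 1 * norm (exp (- ((real k / 2) powr \<alpha>)))"
      by simp
  qed
  also have "(\<lambda>k::nat. exp (- ((real k / 2) powr \<alpha>))) \<in> O(\<lambda>k. 1 / real k ^ 2)"
    using assms by real_asymp
  finally show "(\<lambda>k. exp (- ((real (k div 2) + 1) powr \<alpha>))) \<in> O(\<lambda>k. 1 / real k ^ 2)" .
qed

lemma summable_exp_neg_powr_sum:
  assumes "0 < \<alpha>"
  shows "summable (\<lambda>k. exp (- powr_sum \<alpha> (floor_log k)))"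
proof (rule summable_comparison_test_bigo)
  show "summable (\<lambda>k. norm (1 / real k ^ 2))"
    using inverse_power_summable[of 2, where ?'a = real] by (simp add: field_simps)
  have "(\<lambda>k. exp (- powr_sum \<alpha> (floor_log k))) \<in> O(\<lambda>k. exp (- (((log 2 (real k) - 1) / 2) powr (\<alpha> + 1))))"
  proof (rule bigoI[where c = 1], rule eventually_sequentiallyI[of 2])
    fix k :: nat assume k: "2 \<le> k"
    have "1 \<le> log 2 (real k)" using k by (simp add: le_log_iff)
    moreover have "log 2 (real k) - 1 \<le> real (floor_log k)"
      using k by (simp add: floor_log_altdef)
    ultimately have "((log 2 (real k) - 1) / 2) powr (\<alpha> + 1) \<le> (real (floor_log k) / 2) powr (\<alpha> + 1)"
      using assms by (intro powr_mono2) auto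
    also have "\<dots> \<le> powr_sum \<alpha> (floor_log k)" by (rule powr_sum_lower[OF assms])
    finally show "norm (exp (- powr_sum \<alpha> (floor_log k)))
        \<le> 1 * norm (exp (- (((log 2 (real k) - 1) / 2) powr (\<alpha> + 1))))"
      by simp
  qed
  also have "(\<lambda>k::nat. exp (- (((log 2 (real k) - 1) / 2) powr (\<alpha> + 1)))) \<in> O(\<lambda>k. 1 / real k ^ 2)"
    using assms by real_asymp
  finally show "(\<lambda>k. exp (- powr_sum \<alpha> (floor_log k))) \<in> O(\<lambda>k. 1 / real k ^ 2)" .
qed

lemma ln_le_floor_log: "ln (real n + 2) \<le> real (floor_log n) + 2"
proof -
  have "n < 2 ^ Suc (floor_log n)" using floor_log_exp2_gt[of n] by simp
  moreover have "(2::nat) \<le> 2 ^ Suc (floor_log n)" by simp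
  ultimately have "n + 2 \<le> 2 ^ (floor_log n + 2)" by simp
  then have "real (n + 2) \<le> real (2 ^ (floor_log n + 2))" by (simp only: of_nat_le_iff)
  then have "ln (real n + 2) \<le> ln (2 ^ (floor_log n + 2))"
    by (subst ln_le_cancel_iff) auto
  also have "\<dots> = real (floor_log n + 2) * ln 2" by (subst ln_realpow) auto
  also have "\<dots> \<le> real (floor_log n + 2) * 1"
    by (intro mult_left_mono) (use ln_2_less_1 in auto)
  finally show ?thesis by simp
qed

lemma floor_log_le_ln:
  assumes "1 \<le> n"
  shows "real (Suc (floor_log n)) \<le> 4 * ln (real n + 2)"
proof -
  have "real (2 ^ floor_log n) \<le> real n"
    using floor_log_exp2_le[of n] assms by (simp only: of_nat_le_iff)
  then have "2 ^ floor_log n \<le> real n + 2"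
    unfolding of_nat_power of_nat_numeral by linarith
  then have "ln (2 ^ floor_log n) \<le> ln (real n + 2)"
    by (subst ln_le_cancel_iff) auto
  then have "real (floor_log n) * ln 2 \<le> ln (real n + 2)"
    by (subst (asm) ln_realpow) auto
  moreover have "real (floor_log n) * (1 / 2) \<le> real (floor_log n) * ln 2"
    using ln2_ge_two_thirds by (intro mult_left_mono) auto
  moreover have "ln 2 \<le> ln (real n + 2)" by (subst ln_le_cancel_iff) auto
  ultimately show ?thesis
    using ln2_ge_two_thirds unfolding of_nat_Suc by linarith
qed

lemma ln_powr_le_powr_sum:
  assumes "0 < \<alpha>"
  shows "ln (real n + 2) powr (\<alpha> + 1)
    \<le> 6 powr (\<alpha> + 1) * powr_sum \<alpha> (floor_log n) + 2 powr (\<alpha> + 1)"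
proof -
  define J where "J = floor_log n"
  have "ln (real n + 2) powr (\<alpha> + 1) \<le> (real J + 2) powr (\<alpha> + 1)"
    using assms ln_le_floor_log[of n] by (intro powr_mono2) (auto simp: J_def)
  also have "\<dots> \<le> 6 powr (\<alpha> + 1) * powr_sum \<alpha> J + 2 powr (\<alpha> + 1)"
  proof (cases "J = 0")
    case True
    then show ?thesis by (simp add: powr_sum_def)
  next
    case False
    then have "(real J + 2) powr (\<alpha> + 1) \<le> (6 * (real J / 2)) powr (\<alpha> + 1)"
      using assms by (intro powr_mono2) auto
    also have "\<dots> = 6 powr (\<alpha> + 1) * (real J / 2) powr (\<alpha> + 1)"
      by (subst powr_mult) auto
    also have "\<dots> \<le> 6 powr (\<alpha> + 1) * powr_sum \<alpha> J"
      using powr_sum_lower[OF assms] by (intro mult_left_mono) auto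
    finally show ?thesis by (simp add: add_increasing2)
  qed
  finally show ?thesis by (simp add: J_def)
qed

theorem theorem1p5:
  fixes \<alpha> :: real
  assumes "\<alpha> > 0"
  shows "\<exists>(X :: (nat \<Rightarrow> complex) inner_module) (Y :: (nat \<Rightarrow> complex) inner_module) K u
      C1 c1 C2 c2 C3 c3 C4 c4.
    complex_hilbert_space X \<and> separable_space (htopology X) \<and>
    complex_hilbert_space Y \<and> separable_space (htopology Y) \<and>
    compactin (htopology X) K \<and>
    u \<in> carrier X \<rightarrow> carrier Y \<and>
    (\<forall>U. openin (htopology X) U \<and> hbounded X U \<longrightarrow> holomorphic_between X Y U u) \<and>
    0 < C1 \<and> 0 < c1 \<and> 0 < C2 \<and> 0 < c2 \<and> 0 < C3 \<and> 0 < c3 \<and> 0 < C4 \<and> 0 < c4 \<and>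
    (\<forall>n::nat. n \<ge> 1 \<longrightarrow>
      ennreal (C1 * exp (- c1 * real n powr \<alpha>)) \<le> kolmogorov_width X n K \<and>
      kolmogorov_width X n K \<le> ennreal (C2 * exp (- c2 * real n powr \<alpha>)) \<and>
      ennreal (C3 * exp (- c3 * ln (real n + 2) powr (\<alpha> + 1))) \<le> kolmogorov_width Y n (u ` K) \<and>
      kolmogorov_width Y n (u ` K) \<le> ennreal (C4 * exp (- c4 * ln (real n + 2) powr (\<alpha> + 1))))"
proof -
  define p where "p = \<alpha> + 1"
  have p: "0 < p" using assms by (simp add: p_def)
  define w where "w k = (real (k div 2) + 1) powr \<alpha>" for k :: nat
  define v where "v k = powr_sum \<alpha> (floor_log k)" for k
  define \<tau> where "\<tau> j = exp (- ((real j + 1) powr \<alpha>))" for j :: nat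
  define K where "K = {x :: nat \<Rightarrow> complex. \<forall>k. cmod (x k) \<le> \<tau> (k div 2)}"
  have \<tau>_w: "\<tau> (k div 2) = exp (- w k)" for k by (simp add: \<tau>_def w_def)
  have prod_\<tau>: "(\<Prod>j<J. \<tau> j) = exp (- powr_sum \<alpha> J)" for J
    unfolding \<tau>_def powr_sum_def by (simp add: exp_sum[symmetric] sum_negf)
  have mono_w: "mono w"
    unfolding w_def using assms by (intro monoI powr_mono2) (auto intro: div_le_mono)
  have mono_v: "mono v"
    unfolding v_def by (intro monoI monoD[OF mono_powr_sum] monoD[OF floor_log_mono])
  have sum_w: "summable (\<lambda>k. exp (- w k))"
    unfolding w_def by (rule summable_exp_neg_powr[OF assms])
  have sum_v: "summable (\<lambda>k. exp (- v k))"
    unfolding v_def by (rule summable_exp_neg_powr_sum[OF assms])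
  have sum_\<tau>2: "summable (\<lambda>k. (\<tau> (k div 2))\<^sup>2)"
  proof (rule summable_comparison_test_ev[OF _ sum_w], rule always_eventually, rule allI)
    fix k
    have "0 \<le> w k" by (simp add: w_def)
    then show "norm ((\<tau> (k div 2))\<^sup>2) \<le> exp (- w k)"
      by (simp add: \<tau>_w power2_eq_square flip: exp_add)
  qed
  have K_sub: "K \<subseteq> carrier ell2"
    using carrier_ell2_dominated[OF sum_\<tau>2] by (auto simp: K_def)
  have uK_sub: "monom_map ` K \<subseteq> carrier ell2"
    using K_sub monom_map_carrier by auto
  have u_bound: "cmod (a k) \<le> exp (- v k)" if "a \<in> monom_map ` K" for a k
    using that path_prod_dominated[of _ \<tau> "floor_log k" k]
    by (auto simp: K_def monom_map_def v_def prod_\<tau>)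
  have lower_K: "ennreal (1 * exp (- (2 powr \<alpha>) * real n powr \<alpha>)) \<le> kolmogorov_width ell2 n K"
    if n: "1 \<le> n" for n
  proof -
    have "w n \<le> (2 * real n) powr \<alpha>"
      unfolding w_def using assms n by (intro powr_mono2) linarith+
    then have "1 * exp (- (2 powr \<alpha>) * real n powr \<alpha>) \<le> exp (- w n)"
      by (simp add: powr_mult)
    moreover have "ennreal (exp (- w n)) \<le> kolmogorov_width ell2 n K"
      unfolding K_def
    proof (rule box_lower_width[OF sum_\<tau>2])
      fix k assume "k \<le> n"
      then show "exp (- w n) \<le> \<tau> (k div 2)" using mono_w by (simp add: \<tau>_w monoD)
    qed (auto simp: \<tau>_w)
    ultimately show ?thesis by (meson ennreal_leI order_trans)
  qed
  have upper_K: "kolmogorov_width ell2 n K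
    \<le> ennreal (sqrt (\<Sum>k. exp (- w k)) * exp (- ((1/2) powr \<alpha> / 2) * real n powr \<alpha>))" for n
  proof -
    have "kolmogorov_width ell2 n K \<le> ennreal (sqrt (\<Sum>k. exp (- w k)) * exp (- w n / 2))"
      by (rule kolmogorov_width_ell2_le_exp[OF K_sub mono_w sum_w]) (auto simp: K_def \<tau>_w)
    also have "(1/2 * real n) powr \<alpha> \<le> w n"
      unfolding w_def using assms by (intro powr_mono2) linarith+
    then have "exp (- w n / 2) \<le> exp (- ((1/2) powr \<alpha> / 2) * real n powr \<alpha>)"
      by (subst (asm) powr_mult) auto
    then have "ennreal (sqrt (\<Sum>k. exp (- w k)) * exp (- w n / 2))
      \<le> ennreal (sqrt (\<Sum>k. exp (- w k)) * exp (- ((1/2) powr \<alpha> / 2) * real n powr \<alpha>))"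
      by (intro ennreal_leI mult_left_mono real_sqrt_ge_zero suminf_nonneg sum_w) auto
    finally show ?thesis .
  qed
  have lower_uK: "ennreal (1 * exp (- (4 powr p) * ln (real n + 2) powr p))
    \<le> kolmogorov_width ell2 n (monom_map ` K)" if n: "1 \<le> n" for n
  proof -
    define J where "J = Suc (floor_log n)"
    have "n < 2 ^ J" using floor_log_exp2_gt[of n] by (simp add: J_def)
    then have "ennreal (exp (- powr_sum \<alpha> J)) \<le> kolmogorov_width ell2 n (monom_map ` K)"
      unfolding prod_\<tau>[symmetric]
      using K_sub by (intro monom_map_box_lower_width) (auto simp: K_def \<tau>_def)
    moreover have "powr_sum \<alpha> J \<le> 4 powr p * ln (real n + 2) powr p"
    proof -
      have "powr_sum \<alpha> J \<le> real J powr p"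
        unfolding p_def by (rule powr_sum_upper[OF assms])
      also have "\<dots> \<le> (4 * ln (real n + 2)) powr p"
        using floor_log_le_ln[OF n] p by (intro powr_mono2) (auto simp: J_def)
      finally show ?thesis by (simp add: powr_mult)
    qed
    then have "ennreal (1 * exp (- (4 powr p) * ln (real n + 2) powr p)) \<le> ennreal (exp (- powr_sum \<alpha> J))"
      by (intro ennreal_leI) simp
    ultimately show ?thesis by (rule order_trans[rotated])
  qed
  define c4 where "c4 = 1 / (2 * 6 powr p)"
  define C4 where "C4 = sqrt (\<Sum>k. exp (- v k)) * exp (c4 * 2 powr p)"
  have upper_uK: "kolmogorov_width ell2 n (monom_map ` K)
    \<le> ennreal (C4 * exp (- c4 * ln (real n + 2) powr p))" for n
  proof -
    have "kolmogorov_width ell2 n (monom_map ` K)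
      \<le> ennreal (sqrt (\<Sum>k. exp (- v k)) * exp (- v n / 2))"
      by (rule kolmogorov_width_ell2_le_exp[OF uK_sub mono_v sum_v]) (rule u_bound)
    also have "c4 * ln (real n + 2) powr p \<le> c4 * (6 powr p * v n + 2 powr p)"
      using ln_powr_le_powr_sum[OF assms, of n]
      unfolding p_def v_def c4_def by (intro mult_left_mono) auto
    then have "- v n / 2 \<le> c4 * 2 powr p + - c4 * ln (real n + 2) powr p"
      by (simp add: c4_def distrib_left)
    then have "exp (- v n / 2) \<le> exp (c4 * 2 powr p) * exp (- c4 * ln (real n + 2) powr p)"
      unfolding exp_add[symmetric] by (simp only: exp_le_cancel_iff)
    then have "ennreal (sqrt (\<Sum>k. exp (- v k)) * exp (- v n / 2))
      \<le> ennreal (C4 * exp (- c4 * ln (real n + 2) powr p))"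
      unfolding C4_def mult.assoc
      by (intro ennreal_leI mult_left_mono real_sqrt_ge_zero suminf_nonneg sum_v) auto
    finally show ?thesis .
  qed
  have pos: "0 < sqrt (\<Sum>k. exp (- w k))" "0 < C4" "0 < c4"
    using suminf_pos[OF sum_w] suminf_pos[OF sum_v] by (auto simp: C4_def c4_def)
  have compact: "compactin (htopology ell2) K"
    unfolding K_def by (rule compactin_ell2_box[OF sum_\<tau>2])
  show ?thesis
    by (rule exI[of _ ell2], rule exI[of _ ell2], rule exI[of _ K], rule exI[of _ monom_map],
        rule exI[of _ 1], rule exI[of _ "2 powr \<alpha>"],
        rule exI[of _ "sqrt (\<Sum>k. exp (- w k))"], rule exI[of _ "(1/2) powr \<alpha> / 2"],
        rule exI[of _ 1], rule exI[of _ "4 powr p"], rule exI[of _ C4], rule exI[of _ c4])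
      (use pos compact lower_K upper_K lower_uK upper_uK separable_ell2 holomorphic_monom_map
        monom_map_carrier ell2.complex_hilbert_space_axioms in \<open>auto simp: p_def\<close>)
qed

end
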